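(* Let $\mathfrak{g}$ be a simple simply laced complex Lie algebra and let $\mathbf{i}\in R(w_0)$ be a reduced word. Let $\varsigma_{\mathbf{i}}=\sum_{i\in I}\varsigma_{\mathbf{i},i}$. If in every Laurent monomial occurring (with non-zero coefficient) in $\varsigma_{\mathbf{i}}$ the exponents of all variables $x_1,\dots,x_N$ have absolute value less than or equal to $1$, then the set of inequalities given by $[\varsigma_{\mathbf{i}}]_{trop}$ is non-redundant.
   Context: Setting. $\mathfrak{g}$ has rank $n$, $I=\{1,\dots,n\}$, Cartan matrix $(c_{i,j})$, Weyl group $W$ with simple reflections $s_i$, longest element $w_0$ of length $N$. $R(w_0)$ is the set of reduced words $\mathbf{i}=(i_1,\dots,i_N)$ of $w_0$, i.e. $w_0=s_{i_1}\cdots s_{i_N}$. A word $\mathbf{j}$ is obtained from $\mathbf{i}$ by a $2$-term move at position $k$ if $(j_k,j_{k+1})=(i_{k+1},i_k)$, $c_{i_k,i_{k+1}}=0$, and all other letters agree; by a $3$-term move at position $k$ if $j_{k-1}=j_{k+1}=i_k$, $j_k=i_{k-1}=i_{k+1}$, $c_{i_k,i_{k+1}}=-1$, and all other letters agree. Any two elements of $R(w_0)$ are connected by such moves. String transition maps. If $\mathbf{j}$ arises from $\mathbf{i}$ by a $3$-term move at position $k$, the piecewise linear map $\Psi^{\mathbf{i}}_{\mathbf{j}}$, $x\mapsto x'$, is $x'_{k-1}=\max(x_{k+1},x_k-x_{k-1})$, $x'_k=x_{k-1}+x_{k+1}$, $x'_{k+1}=\min(x_{k-1},x_k-x_{k+1})$,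 other coordinates unchanged; for a $2$-term move at position $k$ it swaps $x_k$ and $x_{k+1}$. The subtraction-free birational lift $\widehat\Psi^{\mathbf{i}}_{\mathbf{j}}:(\mathbb{C}^* )^N\dashrightarrow(\mathbb{C}^* )^N$ is, for a $3$-term move, $x'_{k-1}=\frac{x_kx_{k+1}}{x_k+x_{k-1}x_{k+1}}$, $x'_k=x_{k-1}x_{k+1}$, $x'_{k+1}=x_{k-1}+\frac{x_k}{x_{k+1}}$, other coordinates unchanged, and for a $2$-term move the same swap; its tropicalization is $\Psi^{\mathbf{i}}_{\mathbf{j}}$. For arbitrary $\mathbf{i},\mathbf{j}$ one composes along a sequence of moves. The functions $\varsigma_{\mathbf{i},i}$ ($\mathbf{i}\in R(w_0)$, $i\in I$) are the rational functions in $x_1,\dots,x_N$ determined by: (1) if $i_N=i$ then $\varsigma_{\mathbf{i},i}(x)=x_N$; (2) $\varsigma_{\mathbf{i},i}\circ\widehat\Psi^{\mathbf{j}}_{\mathbf{i}}=\varsigma_{\mathbf{j},i}$ for all $\mathbf{i},\mathbf{j}\in R(w_0)$. They are Laurent polynomials with non-negative integer coefficients. Tropicalization: for a Laurent polynomial $f=\sum_u a_ux^u$ with coefficients $a_u\geq 0$, $[f]_{trop}(t)=\min_{u:\,a_u\ne0}\langle t,u\rangle$ with the standard inner product. The set of inequalities given by $[f]_{trop}$ is $\{\langle t,u\rangle\ge0 : a_u\neq0\}$ (one inequality per Laurent monomial of $f$). Such a set is redundant if for some monomial $x^{u_0}$ of $f$ the linear form $\langle\cdot,u_0\rangle$ is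 a linear combination with non-negative real coefficients of the linear forms $\langle\cdot,u\rangle$ of the other monomials $x^u$ of $f$; otherwise it is non-redundant. *)

theory Defs
  imports
    Complex_Main
    "HOL-Library.Poly_Mapping"
    "HOL-Computational_Algebra.Fraction_Field"
begin

section \<open>Simple complex Lie algebras and their Cartan matrices\<close>

text \<open>The Lie algebra is the whole type \<open>'g\<close>; \<open>I = {1..n}\<close>.\<close>

locale complex_lie_algebra = vector_space scale
  for scale :: "complex \<Rightarrow> 'g::ab_group_add \<Rightarrow> 'g" (infixr "*s" 75) +
  fixes bracket :: "'g \<Rightarrow> 'g \<Rightarrow> 'g"
  assumes finite_dim: "\<exists>B. finite B \<and> span B = UNIV"
    and bracket_add_left: "bracket (x + y) z = bracket x z + bracket y z"
    and bracket_add_right: "bracket x (y + z) = bracket x y + bracket x z"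
    and bracket_scale_left: "bracket (a *s x) y = a *s bracket x y"
    and bracket_scale_right: "bracket x (a *s y) = a *s bracket x y"
    and bracket_self: "bracket x x = 0"
    and jacobi: "bracket x (bracket y z) + bracket y (bracket z x) + bracket z (bracket x y) = 0"
begin

definition ideal :: "'g set \<Rightarrow> bool" where
  "ideal J \<longleftrightarrow> subspace J \<and> (\<forall>x. \<forall>y\<in>J. bracket x y \<in> J)"

definition simple :: bool where
  "simple \<longleftrightarrow> (\<exists>x y. bracket x y \<noteq> 0) \<and> (\<forall>J. ideal J \<longrightarrow> J = {0} \<or> J = UNIV)"

primrec lower_central :: "'g set \<Rightarrow> nat \<Rightarrow> 'g set" where
  "lower_central H 0 = H"
| "lower_central H (Suc k) = span {bracket x y | x y. x \<in> H \<and> y \<in> lower_central H k}"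

definition cartan_subalgebra :: "'g set \<Rightarrow> bool" where
  "cartan_subalgebra H \<longleftrightarrow>
     subspace H \<and> (\<forall>x\<in>H. \<forall>y\<in>H. bracket x y \<in> H) \<and>
     (\<exists>k. lower_central H k = {0}) \<and>
     {x. \<forall>y\<in>H. bracket x y \<in> H} = H"

text \<open>Elements of the dual space of \<open>H\<close> are functions that are linear on \<open>H\<close> and,
  to make them unique, vanish outside \<open>H\<close>.\<close>

definition dual :: "'g set \<Rightarrow> ('g \<Rightarrow> complex) set" where
  "dual H = {\<beta>. (\<forall>x\<in>H. \<forall>y\<in>H. \<beta> (x + y) = \<beta> x + \<beta> y) \<and>
                (\<forall>a. \<forall>x\<in>H. \<beta> (a *s x) = a * \<beta> x) \<and> (\<forall>x. x \<notin> H \<longrightarrow> \<beta> x = 0)}"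

definition root_space :: "'g set \<Rightarrow> ('g \<Rightarrow> complex) \<Rightarrow> 'g set" where
  "root_space H \<beta> = {x. \<forall>h\<in>H. bracket h x = \<beta> h *s x}"

definition roots :: "'g set \<Rightarrow> ('g \<Rightarrow> complex) set" where
  "roots H = {\<beta> \<in> dual H. (\<exists>h\<in>H. \<beta> h \<noteq> 0) \<and> root_space H \<beta> \<noteq> {0}}"

definition simple_roots :: "'g set \<Rightarrow> nat \<Rightarrow> (nat \<Rightarrow> 'g \<Rightarrow> complex) \<Rightarrow> bool" where
  "simple_roots H n \<alpha> \<longleftrightarrow>
     (\<forall>i\<in>{1..n}. \<alpha> i \<in> roots H) \<and>
     (\<forall>a. (\<forall>h\<in>H. (\<Sum>i=1..n. a i * \<alpha> i h) = 0) \<longrightarrow> (\<forall>i\<in>{1..n}. a i = 0)) \<and>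
     (\<forall>\<beta>\<in>roots H. \<exists>m :: nat \<Rightarrow> int.
        ((\<forall>i\<in>{1..n}. m i \<ge> 0) \<or> (\<forall>i\<in>{1..n}. m i \<le> 0)) \<and>
        (\<forall>h\<in>H. \<beta> h = (\<Sum>i=1..n. of_int (m i) * \<alpha> i h)))"

definition coroot :: "'g set \<Rightarrow> ('g \<Rightarrow> complex) \<Rightarrow> 'g \<Rightarrow> bool" where
  "coroot H \<beta> h \<longleftrightarrow>
     h \<in> span {bracket x y | x y. x \<in> root_space H \<beta> \<and> y \<in> root_space H (\<lambda>z. - \<beta> z)} \<and> \<beta> h = 2"

definition is_cartan_matrix :: "nat \<Rightarrow> (nat \<Rightarrow> nat \<Rightarrow> int) \<Rightarrow> bool" where
  "is_cartan_matrix n c \<longleftrightarrow>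
     (\<exists>H \<alpha> h. cartan_subalgebra H \<and> simple_roots H n \<alpha> \<and>
        (\<forall>i\<in>{1..n}. coroot H (\<alpha> i) (h i)) \<and>
        (\<forall>i\<in>{1..n}. \<forall>j\<in>{1..n}. of_int (c i j) = \<alpha> j (h i)))"

end

definition simply_laced :: "nat \<Rightarrow> (nat \<Rightarrow> nat \<Rightarrow> int) \<Rightarrow> bool" where
  "simply_laced n c \<longleftrightarrow>
     (\<forall>i\<in>{1..n}. \<forall>j\<in>{1..n}. i \<noteq> j \<longrightarrow> c i j = c j i \<and> c i j \<in> {0, -1})"


section \<open>Weyl group and reduced words of the longest element\<close>

text \<open>The Weyl group acts on the root lattice; \<open>v\<close> stands for the sum of the
  \<open>v j * \<alpha>\<^sub>j\<close>, and \<open>c i j\<close> is the value of the simple root \<open>\<alpha>\<^sub>j\<close> on the \<open>i\<close>-th simple coroot.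
  Coordinates outside \<open>{1..n}\<close> are left alone.\<close>

definition simple_refl :: "nat \<Rightarrow> (nat \<Rightarrow> nat \<Rightarrow> int) \<Rightarrow> nat \<Rightarrow> (nat \<Rightarrow> int) \<Rightarrow> (nat \<Rightarrow> int)" where
  "simple_refl n c i v = v(i := v i - (\<Sum>j=1..n. c i j * v j))"

definition word_prod :: "nat \<Rightarrow> (nat \<Rightarrow> nat \<Rightarrow> int) \<Rightarrow> nat list \<Rightarrow> (nat \<Rightarrow> int) \<Rightarrow> (nat \<Rightarrow> int)" where
  "word_prod n c w = foldr (\<lambda>i g. simple_refl n c i \<circ> g) w id"

definition weyl_group :: "nat \<Rightarrow> (nat \<Rightarrow> nat \<Rightarrow> int) \<Rightarrow> ((nat \<Rightarrow> int) \<Rightarrow> (nat \<Rightarrow> int)) set" where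
  "weyl_group n c = {word_prod n c w | w. set w \<subseteq> {1..n}}"

definition weyl_length :: "nat \<Rightarrow> (nat \<Rightarrow> nat \<Rightarrow> int) \<Rightarrow> ((nat \<Rightarrow> int) \<Rightarrow> (nat \<Rightarrow> int)) \<Rightarrow> nat" where
  "weyl_length n c g = (LEAST l. \<exists>w. set w \<subseteq> {1..n} \<and> word_prod n c w = g \<and> length w = l)"

definition longest_element :: "nat \<Rightarrow> (nat \<Rightarrow> nat \<Rightarrow> int) \<Rightarrow> ((nat \<Rightarrow> int) \<Rightarrow> (nat \<Rightarrow> int)) \<Rightarrow> bool" where
  "longest_element n c g \<longleftrightarrow>
     g \<in> weyl_group n c \<and> (\<forall>g'\<in>weyl_group n c. weyl_length n c g' \<le> weyl_length n c g)"

definition reduced_words ::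
    "nat \<Rightarrow> (nat \<Rightarrow> nat \<Rightarrow> int) \<Rightarrow> ((nat \<Rightarrow> int) \<Rightarrow> (nat \<Rightarrow> int)) \<Rightarrow> nat list set" where
  "reduced_words n c g =
     {w. set w \<subseteq> {1..n} \<and> word_prod n c w = g \<and> length w = weyl_length n c g}"

text \<open>Positions in a word are counted from 1; a 3-term move is at its middle position.\<close>

definition move2 :: "(nat \<Rightarrow> nat \<Rightarrow> int) \<Rightarrow> nat \<Rightarrow> nat list \<Rightarrow> nat list \<Rightarrow> bool" where
  "move2 c k w w' \<longleftrightarrow>
     (\<exists>us vs a b. w = us @ [a, b] @ vs \<and> w' = us @ [b, a] @ vs \<and>
        k = length us + 1 \<and> c a b = 0)"

definition move3 :: "(nat \<Rightarrow> nat \<Rightarrow> int) \<Rightarrow> nat \<Rightarrow> nat list \<Rightarrow> nat list \<Rightarrow> bool" where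
  "move3 c k w w' \<longleftrightarrow>
     (\<exists>us vs a b. w = us @ [a, b, a] @ vs \<and> w' = us @ [b, a, b] @ vs \<and>
        k = length us + 2 \<and> c b a = -1)"


section \<open>Rational functions\<close>

text \<open>Rational functions in \<open>x\<^sub>0, x\<^sub>1, \<dots>\<close>; those in \<open>x\<^sub>1, \<dots>, x\<^sub>N\<close> form a subfield.\<close>

type_synonym mpoly = "(nat \<Rightarrow>\<^sub>0 nat) \<Rightarrow>\<^sub>0 complex"
type_synonym ratfun = "mpoly fract"
type_synonym laurent = "(nat \<Rightarrow>\<^sub>0 int) \<Rightarrow>\<^sub>0 complex"

definition rf_const :: "complex \<Rightarrow> ratfun" where
  "rf_const a = Fract (Poly_Mapping.single 0 a) 1"

definition rf_var :: "nat \<Rightarrow> ratfun" where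
  "rf_var k = Fract (Poly_Mapping.single (Poly_Mapping.single k 1) 1) 1"

definition poly_subst :: "(nat \<Rightarrow> ratfun) \<Rightarrow> mpoly \<Rightarrow> ratfun" where
  "poly_subst \<Phi> p = (\<Sum>m\<in>Poly_Mapping.keys p. rf_const (Poly_Mapping.lookup p m) *
     (\<Prod>k\<in>Poly_Mapping.keys m. \<Phi> k ^ Poly_Mapping.lookup m k))"

text \<open>\<open>rf_subst \<Phi> f\<close> is \<open>f \<circ> \<Phi>\<close>, for \<open>f\<close> having a denominator that does not
  become 0 under the substitution of \<open>\<Phi> k\<close> for \<open>x\<^sub>k\<close>; it does not depend on the chosen fraction,
  see \<open>rf_subst_Fract\<close> below.\<close>

definition rf_subst :: "(nat \<Rightarrow> ratfun) \<Rightarrow> ratfun \<Rightarrow> ratfun" where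
  "rf_subst \<Phi> f = (THE g. \<exists>p q. q \<noteq> 0 \<and> f = Fract p q \<and>
     poly_subst \<Phi> q \<noteq> 0 \<and> g = poly_subst \<Phi> p / poly_subst \<Phi> q)"

definition laurent_to_rf :: "laurent \<Rightarrow> ratfun" where
  "laurent_to_rf F = (\<Sum>u\<in>Poly_Mapping.keys F. rf_const (Poly_Mapping.lookup F u) *
     (\<Prod>k\<in>Poly_Mapping.keys u. rf_var k powi Poly_Mapping.lookup u k))"

lemma rf_const_add: "rf_const (a + b) = rf_const a + rf_const b"
  by (simp add: rf_const_def single_add)

lemma rf_const_mult: "rf_const (a * b) = rf_const a * rf_const b"
  by (simp add: rf_const_def mult_single)

lemma rf_const_0: "rf_const 0 = 0"
  by (simp add: rf_const_def Zero_fract_def)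

lemma poly_subst_superset:
  assumes "finite A" "Poly_Mapping.keys p \<subseteq> A"
  shows "poly_subst \<Phi> p = (\<Sum>m\<in>A. rf_const (Poly_Mapping.lookup p m) *
     (\<Prod>k\<in>Poly_Mapping.keys m. \<Phi> k ^ Poly_Mapping.lookup m k))"
  unfolding poly_subst_def using assms
  by (intro sum.mono_neutral_left) (auto simp: rf_const_0 in_keys_iff)

lemma poly_subst_add: "poly_subst \<Phi> (p + q) = poly_subst \<Phi> p + poly_subst \<Phi> q"
proof -
  let ?A = "Poly_Mapping.keys p \<union> Poly_Mapping.keys q"
  have "Poly_Mapping.keys (p + q) \<subseteq> ?A" by (rule Poly_Mapping.keys_add)
  then show ?thesis
    by (simp add: poly_subst_superset[of ?A] lookup_add rf_const_add distrib_right sum.distrib)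
qed

lemma poly_subst_0: "poly_subst \<Phi> 0 = 0"
  by (simp add: poly_subst_def)

lemma poly_subst_sum: "poly_subst \<Phi> (sum f A) = (\<Sum>a\<in>A. poly_subst \<Phi> (f a))"
  by (induction A rule: infinite_finite_induct) (auto simp: poly_subst_0 poly_subst_add)

lemma poly_subst_single:
  "poly_subst \<Phi> (Poly_Mapping.single m a) =
     rf_const a * (\<Prod>k\<in>Poly_Mapping.keys m. \<Phi> k ^ Poly_Mapping.lookup m k)"
  by (cases "a = 0") (auto simp: poly_subst_def rf_const_0)

lemma monom_prod_add:
  fixes \<Phi> :: "nat \<Rightarrow> ratfun" and m m' :: "nat \<Rightarrow>\<^sub>0 nat"
  shows "(\<Prod>k\<in>Poly_Mapping.keys (m + m'). \<Phi> k ^ Poly_Mapping.lookup (m + m') k) =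
    (\<Prod>k\<in>Poly_Mapping.keys m. \<Phi> k ^ Poly_Mapping.lookup m k) *
    (\<Prod>k\<in>Poly_Mapping.keys m'. \<Phi> k ^ Poly_Mapping.lookup m' k)"
proof -
  let ?A = "Poly_Mapping.keys m \<union> Poly_Mapping.keys m'"
  have *: "(\<Prod>k\<in>Poly_Mapping.keys r. \<Phi> k ^ Poly_Mapping.lookup r k) =
      (\<Prod>k\<in>?A. \<Phi> k ^ Poly_Mapping.lookup r k)" if "Poly_Mapping.keys r \<subseteq> ?A" for r
    using that by (intro prod.mono_neutral_left) (auto simp: in_keys_iff)
  show ?thesis
    by (subst (1 2 3) *) (auto simp: Poly_Mapping.keys_add lookup_add power_add prod.distrib
        dest: subsetD[OF Poly_Mapping.keys_add])
qed

lemma mpoly_sum_single: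
  fixes p :: mpoly
  shows "p = (\<Sum>m\<in>Poly_Mapping.keys p. Poly_Mapping.single m (Poly_Mapping.lookup p m))"
proof (rule poly_mapping_eqI)
  fix k
  show "Poly_Mapping.lookup p k = Poly_Mapping.lookup
    (\<Sum>m\<in>Poly_Mapping.keys p. Poly_Mapping.single m (Poly_Mapping.lookup p m)) k"
    by (simp add: lookup_sum lookup_single when_def in_keys_iff)
qed

lemma poly_subst_mult: "poly_subst \<Phi> (p * q) = poly_subst \<Phi> p * poly_subst \<Phi> q"
proof -
  let ?s = "\<lambda>p m. Poly_Mapping.single m (Poly_Mapping.lookup p m)"
  have "p * q = (\<Sum>m\<in>Poly_Mapping.keys p. \<Sum>m'\<in>Poly_Mapping.keys q. ?s p m * ?s q m')"
    by (simp only: sum_product[symmetric] mpoly_sum_single[symmetric])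
  then have "poly_subst \<Phi> (p * q) =
     (\<Sum>m\<in>Poly_Mapping.keys p. \<Sum>m'\<in>Poly_Mapping.keys q. poly_subst \<Phi> (?s p m * ?s q m'))"
    by (simp add: poly_subst_sum)
  also have "\<dots> = (\<Sum>m\<in>Poly_Mapping.keys p. \<Sum>m'\<in>Poly_Mapping.keys q.
       poly_subst \<Phi> (?s p m) * poly_subst \<Phi> (?s q m'))"
    by (intro sum.cong refl)
      (simp add: mult_single poly_subst_single monom_prod_add rf_const_mult mult.assoc mult.left_commute)
  also have "\<dots> = (\<Sum>m\<in>Poly_Mapping.keys p. poly_subst \<Phi> (?s p m)) *
       (\<Sum>m'\<in>Poly_Mapping.keys q. poly_subst \<Phi> (?s q m'))"
    by (simp add: sum_product)
  also have "\<dots> = poly_subst \<Phi> p * poly_subst \<Phi> q"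
    by (simp only: poly_subst_sum[symmetric] mpoly_sum_single[symmetric])
  finally show ?thesis .
qed

lemma rf_subst_Fract:
  assumes "q \<noteq> 0" "poly_subst \<Phi> q \<noteq> 0"
  shows "rf_subst \<Phi> (Fract p q) = poly_subst \<Phi> p / poly_subst \<Phi> q"
  unfolding rf_subst_def
proof (rule the_equality)
  show "\<exists>p' q'. q' \<noteq> 0 \<and> Fract p q = Fract p' q' \<and> poly_subst \<Phi> q' \<noteq> 0 \<and>
      poly_subst \<Phi> p / poly_subst \<Phi> q = poly_subst \<Phi> p' / poly_subst \<Phi> q'"
    using assms by blast
next
  fix g
  assume "\<exists>p' q'. q' \<noteq> 0 \<and> Fract p q = Fract p' q' \<and> poly_subst \<Phi> q' \<noteq> 0 \<and>
      g = poly_subst \<Phi> p' / poly_subst \<Phi> q'"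
  then obtain p' q' where *: "q' \<noteq> 0" "Fract p q = Fract p' q'" "poly_subst \<Phi> q' \<noteq> 0"
      "g = poly_subst \<Phi> p' / poly_subst \<Phi> q'" by blast
  then have "p * q' = p' * q" using assms by (simp add: eq_fract)
  then have "poly_subst \<Phi> p * poly_subst \<Phi> q' = poly_subst \<Phi> p' * poly_subst \<Phi> q"
    by (metis poly_subst_mult)
  then show "g = poly_subst \<Phi> p / poly_subst \<Phi> q"
    using * assms by (simp add: frac_eq_eq)
qed


section \<open>String transition maps and the functions \<open>\<sigma>\<close>\<close>

definition psi2 :: "nat \<Rightarrow> (nat \<Rightarrow> 'a::field) \<Rightarrow> (nat \<Rightarrow> 'a)" where
  "psi2 k x = x(k := x (k + 1), k + 1 := x k)"

definition psi3 :: "nat \<Rightarrow> (nat \<Rightarrow> 'a::field) \<Rightarrow> (nat \<Rightarrow> 'a)" where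
  "psi3 k x = x(k - 1 := x k * x (k + 1) / (x k + x (k - 1) * x (k + 1)),
                k := x (k - 1) * x (k + 1),
                k + 1 := x (k - 1) + x k / x (k + 1))"

text \<open>\<open>transition c i j \<Phi>\<close>: composing the birational maps of some sequence of moves from \<open>i\<close> to \<open>j\<close>
  yields the map whose \<open>k\<close>-th coordinate is the rational function \<open>\<Phi> k\<close> of the coordinates \<open>x\<close>
  belonging to \<open>i\<close>.\<close>

inductive transition ::
    "(nat \<Rightarrow> nat \<Rightarrow> int) \<Rightarrow> nat list \<Rightarrow> nat list \<Rightarrow> (nat \<Rightarrow> ratfun) \<Rightarrow> bool"
  for c :: "nat \<Rightarrow> nat \<Rightarrow> int" where
  refl: "transition c i i rf_var"
| move2: "transition c i j \<Phi> \<Longrightarrow> move2 c k j j' \<Longrightarrow> transition c i j' (psi2 k \<Phi>)"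
| move3: "transition c i j \<Phi> \<Longrightarrow> move3 c k j j' \<Longrightarrow> transition c i j' (psi3 k \<Phi>)"

text \<open>The two conditions characterizing the family \<open>\<sigma> i a\<close> (\<open>i\<close> a reduced word of \<open>w0\<close>,
  \<open>1 \<le> a \<le> n\<close>).\<close>

definition varsigma_family ::
    "nat \<Rightarrow> (nat \<Rightarrow> nat \<Rightarrow> int) \<Rightarrow> ((nat \<Rightarrow> int) \<Rightarrow> (nat \<Rightarrow> int)) \<Rightarrow> (nat list \<Rightarrow> nat \<Rightarrow> ratfun) \<Rightarrow> bool"
  where
  "varsigma_family n c w0 \<sigma> \<longleftrightarrow>
     (\<forall>i\<in>reduced_words n c w0. \<forall>a\<in>{1..n}.
        i \<noteq> [] \<and> last i = a \<longrightarrow> \<sigma> i a = rf_var (length i)) \<and>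
     (\<forall>i\<in>reduced_words n c w0. \<forall>j\<in>reduced_words n c w0. \<forall>a\<in>{1..n}. \<forall>\<Phi>.
        transition c j i \<Phi> \<longrightarrow> rf_subst \<Phi> (\<sigma> i a) = \<sigma> j a)"


section \<open>Inequalities of a tropicalized Laurent polynomial\<close>

definition lin_form :: "nat \<Rightarrow> (nat \<Rightarrow>\<^sub>0 int) \<Rightarrow> (nat \<Rightarrow> real) \<Rightarrow> real" where
  "lin_form N u t = (\<Sum>k=1..N. t k * of_int (Poly_Mapping.lookup u k))"

text \<open>The inequalities given by the tropicalization of \<open>F\<close> are \<open>lin_form N u t \<ge> 0\<close>, one for each
  exponent \<open>u\<close> in \<open>keys F\<close>.\<close>

definition redundant :: "nat \<Rightarrow> laurent \<Rightarrow> bool" where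
  "redundant N F \<longleftrightarrow>
     (\<exists>u0\<in>Poly_Mapping.keys F. \<exists>a :: (nat \<Rightarrow>\<^sub>0 int) \<Rightarrow> real.
        (\<forall>u\<in>Poly_Mapping.keys F - {u0}. a u \<ge> 0) \<and>
        (\<forall>t. lin_form N u0 t = (\<Sum>u\<in>Poly_Mapping.keys F - {u0}. a u * lin_form N u t)))"

end

theory Submission
  imports Defs "HOL-Library.Complex_Order"
begin

text \<open>
  In the coordinates of the word \<open>i\<close> put \<open>z\<^sub>l = x\<^sub>l\<^bsup>-1\<^esup> \<Prod>\<^bsub>q > l\<^esub> x\<^sub>q\<^bsup>- c(i\<^sub>q, i\<^sub>l)\<^esup>\<close>. The vector fields
  \<open>\<Theta>\<^sub>b = \<Sum>\<^bsub>i\<^sub>l = b\<^esub> z\<^sub>l x\<^sub>l \<partial>/\<partial>x\<^sub>l\<close> (the action of the Chevalley generator \<open>e\<^sub>b\<close>) do not depend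
  on the chart: they are preserved by the transition maps. In a chart whose word ends with \<open>a\<close> one reads
  off \<open>\<Theta>\<^sub>b \<sigma>\<^sub>a = \<delta>\<^sub>a\<^sub>b\<close>. In the same way \<open>\<sigma>\<^sub>a\<close> is homogeneous of degree the simple root \<open>a\<close>, if \<open>x\<^sub>l\<close> has
  degree the positive root attached to \<open>l\<close>. Comparing coefficients in \<open>\<Theta>\<^sub>b F = 1\<close> relates the
  coefficients at the exponents \<open>w - \<zeta>\<^sub>l\<close>, \<open>i\<^sub>l = b\<close>, where \<open>z\<^sub>l = x\<close> to the power \<open>\<zeta>\<^sub>l\<close>.

  If all exponents lie between \<open>-1\<close> and \<open>1\<close>, each such relation has at most two nonzero terms. Hence
  every exponent is obtained from the exponent \<open>- \<zeta>\<^sub>l\<close> of the last occurrence \<open>l\<close> of its letter by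
  firings: if two consecutive occurrences \<open>q < r\<close> of a letter carry \<open>0\<close> and \<open>-1\<close>, one may add
  \<open>\<zeta>\<^sub>r - \<zeta>\<^sub>q\<close>. Different enabled firings do not disturb each other, so the vectors of firing numbers
  are closed under componentwise maxima. This excludes two exponents of the same degree that agree before a
  position and have the entries \<open>1\<close> and \<open>-1\<close> there. A redundant inequality would be a convex combination
  of others of the same degree, and the first position where these differ would give such a pair.
\<close>

section \<open>Reflections and reduced words\<close>

locale simply_laced_matrix =
  fixes n :: nat and c :: "nat \<Rightarrow> nat \<Rightarrow> int"
  assumes c_diag: "i \<in> {1..n} \<Longrightarrow> c i i = 2"
    and c_off: "i \<in> {1..n} \<Longrightarrow> j \<in> {1..n} \<Longrightarrow> i \<noteq> j \<Longrightarrow> c i j = c j i \<and> c i j \<in> {0, - 1}"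
begin

abbreviation "s \<equiv> simple_refl n c"
abbreviation "wp \<equiv> word_prod n c"

definition letters :: "nat list \<Rightarrow> bool" where
  "letters w \<longleftrightarrow> set w \<subseteq> {1..n}"

lemma letters_simps [simp]:
  "letters []" "letters (x # w) \<longleftrightarrow> x \<in> {1..n} \<and> letters w"
  "letters (w @ w') \<longleftrightarrow> letters w \<and> letters w'" "letters (rev w) \<longleftrightarrow> letters w"
  by (auto simp: letters_def)

text \<open>The value of the \<open>i\<close>-th simple coroot on \<open>v\<close>.\<close>

definition pair :: "nat \<Rightarrow> (nat \<Rightarrow> int) \<Rightarrow> int" where
  "pair i v = (\<Sum>j=1..n. c i j * v j)"

lemma s_eq: "s i v = v(i := v i - pair i v)"
  by (simp add: simple_refl_def pair_def)

lemma s_apply: "s i v x = (if x = i then v i - pair i v else v x)"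
  by (simp add: s_eq)

lemma pair_upd: "b \<in> {1..n} \<Longrightarrow> pair a (v(b := v b + x)) = pair a v + c a b * x"
proof -
  assume b: "b \<in> {1..n}"
  have "(\<Sum>j=1..n. c a j * (v(b := v b + x)) j) = (\<Sum>j=1..n. c a j * v j + (if j = b then c a b * x else 0))"
    by (intro sum.cong) (auto simp: algebra_simps)
  then show ?thesis using b by (simp add: pair_def sum.distrib)
qed

lemma pair_s: "b \<in> {1..n} \<Longrightarrow> pair a (s b v) = pair a v - c a b * pair b v"
  using pair_upd[of b a v "- pair b v"] by (simp add: s_eq)

lemma s_s: "i \<in> {1..n} \<Longrightarrow> s i (s i v) = v"
  by (simp add: fun_eq_iff s_apply pair_s c_diag)

lemma s_commute:
  assumes "a \<in> {1..n}" "b \<in> {1..n}" "c a b = 0"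
  shows "s a (s b v) = s b (s a v)"
proof -
  have "a \<noteq> b" using assms c_diag[of a] by auto
  then have "c b a = 0" using assms c_off[of a b] by auto
  then show ?thesis using \<open>a \<noteq> b\<close> assms by (simp add: fun_eq_iff s_apply pair_s)
qed

lemma s_braid:
  assumes "a \<in> {1..n}" "b \<in> {1..n}" "c a b = - 1"
  shows "s a (s b (s a v)) = s b (s a (s b v))"
proof -
  have "a \<noteq> b" using assms c_diag[of a] by auto
  then have "c b a = - 1" using assms c_off[of a b] by auto
  then show ?thesis using \<open>a \<noteq> b\<close> assms by (simp add: fun_eq_iff s_apply pair_s c_diag)
qed

lemma s_add: "s i (\<lambda>x. u x + v x) = (\<lambda>x. s i u x + s i v x)"
  by (auto simp: s_eq pair_def fun_eq_iff algebra_simps sum.distrib)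

lemma s_mult: "s i (\<lambda>x. k * v x) = (\<lambda>x. k * s i v x)"
  by (auto simp: s_eq pair_def fun_eq_iff algebra_simps sum_distrib_left)

lemma wp_simps [simp]: "wp [] v = v" "wp (x # w) v = s x (wp w v)" "wp (w @ w') v = wp w (wp w' v)"
proof -
  show "wp [] v = v" by (simp add: word_prod_def)
  show *: "wp (x # w) v = s x (wp w v)" for x w v by (simp add: word_prod_def)
  show "wp (w @ w') v = wp w (wp w' v)"
  proof (induction w)
    case Nil
    show ?case by (simp add: word_prod_def)
  qed (simp add: *)
qed

lemma wp_add: "wp w (\<lambda>x. u x + v x) = (\<lambda>x. wp w u x + wp w v x)"
  by (induction w) (simp_all add: s_add)

lemma wp_mult: "wp w (\<lambda>x. k * v x) = (\<lambda>x. k * wp w v x)"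
  by (induction w) (simp_all add: s_mult)

lemma wp_minus: "wp w (\<lambda>x. - v x) = (\<lambda>x. - wp w v x)"
  using wp_mult[of w "- 1" v] by simp

lemma wp_rev: "letters w \<Longrightarrow> wp (rev w) (wp w v) = v"
  by (induction w arbitrary: v) (simp_all add: s_s)

definition \<alpha> :: "nat \<Rightarrow> nat \<Rightarrow> int" where
  "\<alpha> i = (\<lambda>x. if x = i then 1 else 0)"

lemma pair_\<alpha>: "i \<in> {1..n} \<Longrightarrow> pair a (\<alpha> i) = c a i"
proof -
  assume "i \<in> {1..n}"
  moreover have "pair a (\<alpha> i) = (\<Sum>j=1..n. if j = i then c a i else 0)"
    unfolding pair_def \<alpha>_def by (intro sum.cong) auto
  ultimately show ?thesis by simp
qed

lemma s_\<alpha>: "i \<in> {1..n} \<Longrightarrow> s a (\<alpha> i) = (\<lambda>x. \<alpha> i x - c a i * \<alpha> a x)"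
  by (auto simp: s_apply pair_\<alpha> fun_eq_iff) (auto simp: \<alpha>_def)

lemma s_\<alpha>_self: "a \<in> {1..n} \<Longrightarrow> s a (\<alpha> a) = (\<lambda>x. - \<alpha> a x)"
  by (simp add: s_\<alpha> c_diag fun_eq_iff)

section \<open>Length and the sign of roots\<close>

definition len :: "((nat \<Rightarrow> int) \<Rightarrow> (nat \<Rightarrow> int)) \<Rightarrow> nat" where
  "len = weyl_length n c"

lemma len_le: "letters w \<Longrightarrow> len (wp w) \<le> length w"
  unfolding len_def weyl_length_def letters_def by (rule Least_le) blast

lemma len_attained:
  assumes "letters w"
  obtains w' where "letters w'" "wp w' = wp w" "length w' = len (wp w)"
proof -
  have "\<exists>w'. set w' \<subseteq> {1..n} \<and> wp w' = wp w \<and> length w' = len (wp w)"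
    unfolding len_def weyl_length_def
    by (rule LeastI_ex) (use assms in \<open>auto simp: letters_def\<close>)
  then show ?thesis using that by (auto simp: letters_def)
qed

lemma len_append_le:
  assumes "letters u" "letters v"
  shows "len (wp (u @ v)) \<le> len (wp u) + length v"
proof -
  obtain u' where u': "letters u'" "wp u' = wp u" "length u' = len (wp u)"
    using len_attained assms(1) by blast
  have "wp (u @ v) = wp (u' @ v)" by (simp add: fun_eq_iff u'(2))
  then show ?thesis using len_le[of "u' @ v"] u' assms by simp
qed

definition nonneg :: "(nat \<Rightarrow> int) \<Rightarrow> bool" where
  "nonneg v \<longleftrightarrow> (\<forall>x. 0 \<le> v x)"

text \<open>The rank two case analysis with \<open>t\<close> the last letter of a reduced word of \<open>w\<close> different
  from \<open>a\<close>; in each case an element shorter than \<open>w\<close> is sent to a simple root.\<close>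

lemma nonneg_root:
  "letters w \<Longrightarrow> a \<in> {1..n} \<Longrightarrow> len (wp w) \<le> len (wp (w @ [a])) \<Longrightarrow> nonneg (wp w (\<alpha> a))"
proof (induction "len (wp w)" arbitrary: w a rule: less_induct)
  case less
  obtain w' where w': "letters w'" "wp w' = wp w" "length w' = len (wp w)"
    using len_attained less.prems(1) by blast
  show ?case
  proof (cases w' rule: rev_cases)
    case Nil
    then show ?thesis using w'(2) by (simp add: nonneg_def \<alpha>_def flip: w'(2))
  next
    case (snoc v t)
    have vt: "letters v" "t \<in> {1..n}" using w'(1) snoc by auto
    have w_eq: "wp w x = wp v (s t x)" for x using snoc by (simp flip: w'(2))
    have lw: "len (wp w) = Suc (length v)" using w'(3) snoc by simp
    have lv: "len (wp v) = length v"
      using len_le[OF vt(1)] len_append_le[of v "[t]"] vt lw w'(2) snoc by simp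
    have short: "len (wp w) \<le> len (wp v')" if "wp v' = wp (w @ [a])" for v'
      using less.prems(3) that by simp
    have "a \<noteq> t"
    proof
      assume "a = t"
      then have "wp v = wp (w @ [a])" using vt by (simp add: fun_eq_iff w_eq s_s)
      then show False using short[of v] lv lw by simp
    qed
    consider "c t a = 0" | "c t a = - 1" using c_off[of t a] \<open>a \<noteq> t\<close> vt less.prems(2) by auto
    then show ?thesis
    proof cases
      case 1
      have wa: "wp w (\<alpha> a) = wp v (\<alpha> a)" using less.prems(2) 1 by (simp add: w_eq s_\<alpha>)
      have "len (wp v) \<le> len (wp (v @ [a]))"
      proof (rule ccontr)
        assume "\<not> ?thesis"
        moreover have "wp ((v @ [a]) @ [t]) = wp (w @ [a])"
        proof
          fix x show "wp ((v @ [a]) @ [t]) x = wp (w @ [a]) x"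
            by (simp add: w_eq s_commute[OF vt(2) less.prems(2) 1])
        qed
        ultimately show False
          using short[of "(v @ [a]) @ [t]"] len_append_le[of "v @ [a]" "[t]"] vt less.prems(2) lv lw by auto
      qed
      then show ?thesis using less.hyps[of v a] lv lw vt less.prems(2) wa by simp
    next
      case 2
      have "c a t = - 1" using c_off[of t a] \<open>a \<noteq> t\<close> vt less.prems(2) 2 by auto
      have sa: "s t (\<alpha> a) = (\<lambda>x. \<alpha> a x + \<alpha> t x)" using less.prems(2) 2 by (simp add: s_\<alpha>)
      \<comment> \<open>Here \<open>wp w (\<alpha> a)\<close> is the sum of the images of
        \<open>\<alpha> a\<close> and \<open>\<alpha> t\<close> under \<open>v\<close>. The second
        summand is positive because appending \<open>t\<close> to \<open>v\<close> does not
        shorten.\<close>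
      have vt_pos: "nonneg (wp v (\<alpha> t))"
      proof (rule less.hyps)
        have "wp (v @ [t]) = wp w" using snoc w'(2) by simp
        then show "len (wp v) \<le> len (wp (v @ [t]))" using lv lw by simp
      qed (use vt lv lw in auto)
      show ?thesis
      proof (cases "len (wp v) \<le> len (wp (v @ [a]))")
        case True
        have "nonneg (wp v (\<alpha> a))" using less.hyps[of v a] lv lw vt less.prems(2) True by simp
        then show ?thesis using vt_pos by (simp add: w_eq sa wp_add nonneg_def)
      next
        case False
        \<comment> \<open>Now \<open>v @ [a]\<close> is shorter than \<open>v\<close>. Since
          \<open>s t (\<alpha> a) = s a (\<alpha> t)\<close>, the root in question is the image of
          \<open>\<alpha> t\<close> under \<open>?v2\<close>. If appending \<open>t\<close>
          shortened once more, the braid relation would make \<open>w @ [a]\<close> shorter than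
          \<open>w\<close>.\<close>
        let ?v2 = "v @ [a]"
        have "len (wp ?v2) \<le> len (wp (?v2 @ [t]))"
        proof (rule ccontr)
          assume F: "\<not> ?thesis"
          have "wp ((?v2 @ [t]) @ [a, t]) = wp (w @ [a])"
          proof
            fix x show "wp ((?v2 @ [t]) @ [a, t]) x = wp (w @ [a]) x"
              using s_braid[OF less.prems(2) vt(2) \<open>c a t = - 1\<close>, of "s t x"] vt
              by (simp add: w_eq s_s s_braid[OF less.prems(2) vt(2) \<open>c a t = - 1\<close>])
          qed
          then show False
            using short[of "(?v2 @ [t]) @ [a, t]"] len_append_le[of "?v2 @ [t]" "[a, t]"] F False
              vt less.prems(2) lv lw by auto
        qed
        then have "nonneg (wp ?v2 (\<alpha> t))" using less.hyps[of ?v2 t] False lv lw vt less.prems(2) by auto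
        moreover have "s a (\<alpha> t) = s t (\<alpha> a)" using vt less.prems(2) 2 \<open>c a t = - 1\<close> by (simp add: s_\<alpha> add.commute)
        ultimately show ?thesis by (simp add: w_eq)
      qed
    qed
  qed
qed

definition reduced :: "nat list \<Rightarrow> bool" where
  "reduced w \<longleftrightarrow> letters w \<and> len (wp w) = length w"

lemma reduced_letters: "reduced w \<Longrightarrow> letters w"
  by (simp add: reduced_def)

lemma reduced_appendD: "reduced (u @ v) \<Longrightarrow> reduced u"
  using len_append_le[of u v] len_le[of u] by (auto simp: reduced_def)

lemma reduced_cong: "reduced w \<Longrightarrow> letters w' \<Longrightarrow> wp w' = wp w \<Longrightarrow> length w' = length w \<Longrightarrow> reduced w'"
  by (simp add: reduced_def)

text \<open>The reversed word represents the inverse, so reversing a shorter word for the inverse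
  would give a shorter word for the element of \<open>w\<close>.\<close>

lemma reduced_rev: "reduced w \<Longrightarrow> reduced (rev w)"
proof -
  assume w: "reduced w"
  then have l: "letters w" by (simp add: reduced_def)
  obtain w' where w': "letters w'" "wp w' = wp (rev w)" "length w' = len (wp (rev w))"
    using len_attained[of "rev w"] l by auto
  have "wp (rev w') x = wp w x" for x
    using wp_rev[OF w'(1), of "wp w x"] by (simp add: w'(2) wp_rev l)
  then have "wp (rev w') = wp w" by blast
  then have "length w \<le> length w'" using len_le[of "rev w'"] w' w by (simp add: reduced_def)
  then show ?thesis using w' len_le[of "rev w"] l by (simp add: reduced_def)
qed

lemma reduced_snoc_nonneg: "reduced (w @ [a]) \<Longrightarrow> nonneg (wp w (\<alpha> a))"
proof (rule nonneg_root)
  assume r: "reduced (w @ [a])"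
  then show "letters w" "a \<in> {1..n}" by (auto simp: reduced_def)
  show "len (wp w) \<le> len (wp (w @ [a]))"
    using r reduced_appendD[OF r] by (simp add: reduced_def)
qed

section \<open>Moving a prescribed letter to the end of a word\<close>

definition moves :: "nat list \<Rightarrow> nat list \<Rightarrow> bool" where
  "moves = (\<lambda>w w'. (\<exists>k. move2 c k w w') \<or> (\<exists>k. move3 c k w w'))\<^sup>*\<^sup>*"

lemma moves_append:
  assumes "moves w w'"
  shows "moves (w @ v) (w' @ v)"
  using assms unfolding moves_def
proof (induction rule: rtranclp_induct)
  case (step y z)
  have "(\<exists>k. move2 c k (y @ v) (z @ v)) \<or> (\<exists>k. move3 c k (y @ v) (z @ v))"
    using step(2) unfolding move2_def move3_def by (metis append.assoc)
  then show ?case using step(3) by (rule rtranclp.rtrancl_into_rtrancl[rotated])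
qed simp

lemma moves_trans: "moves u v \<Longrightarrow> moves v w \<Longrightarrow> moves u w"
  unfolding moves_def by (rule rtranclp_trans)

lemma moves_step: "move2 c k w w' \<Longrightarrow> moves w w'" "move3 c k w w' \<Longrightarrow> moves w w'"
  unfolding moves_def by blast+

lemma move_invariant:
  assumes "(\<exists>k. move2 c k w w') \<or> (\<exists>k. move3 c k w w')" "letters w"
  shows "letters w' \<and> wp w' = wp w \<and> length w' = length w"
  using assms
proof (elim disjE exE)
  fix k assume "move2 c k w w'"
  then obtain us vs a b where "w = us @ [a, b] @ vs" "w' = us @ [b, a] @ vs" "c a b = 0"
    unfolding move2_def by blast
  then show ?thesis using assms(2) by (auto simp: fun_eq_iff s_commute[of a b])
next
  fix k assume "move3 c k w w'"
  then obtain us vs a b where "w = us @ [a, b, a] @ vs" "w' = us @ [b, a, b] @ vs" "c b a = - 1"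
    unfolding move3_def by blast
  then show ?thesis using assms(2) by (auto simp: fun_eq_iff s_braid[of b a])
qed

lemma moves_invariant:
  assumes "moves w w'" "letters w"
  shows "letters w' \<and> wp w' = wp w \<and> length w' = length w"
  using assms(1) unfolding moves_def
proof (induction rule: rtranclp_induct)
  case (step y z)
  then show ?case using move_invariant[of y z] by auto
qed (use assms(2) in simp)

lemma moves_reduced: "moves w w' \<Longrightarrow> reduced w \<Longrightarrow> reduced w'"
  using moves_invariant reduced_cong by (metis reduced_letters)

text \<open>Strip the last letter \<open>b\<close> of \<open>w\<close>. For the remaining word the
  root of \<open>a\<close> is still negative: it is unchanged if the letters commute, and otherwise
  it loses the positive root of \<open>b\<close>. So induction brings \<open>a\<close> to the end of
  the remaining word. Commuting letters are then swapped; otherwise a second induction puts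
  \<open>b\<close> in front of \<open>a b\<close>, and a braid move finishes.\<close>

lemma moves_to_last:
  "reduced w \<Longrightarrow> a \<in> {1..n} \<Longrightarrow> nonneg (\<lambda>x. - wp w (\<alpha> a) x) \<Longrightarrow> \<exists>v. moves w (v @ [a])"
proof (induction "length w" arbitrary: w a rule: less_induct)
  case less
  show ?case
  proof (cases w rule: rev_cases)
    case Nil
    then show ?thesis using less.prems(3) by (auto simp: nonneg_def \<alpha>_def dest: spec[of _ a])
  next
    case (snoc h b)
    have h: "reduced h" "letters h" "b \<in> {1..n}"
      using less.prems(1) reduced_appendD[of h "[b]"] snoc by (auto simp: reduced_def)
    show ?thesis
    proof (cases "a = b")
      case True
      then show ?thesis using snoc by (auto simp: moves_def)
    next
      case False
      have hb: "nonneg (wp h (\<alpha> b))" using reduced_snoc_nonneg less.prems(1) snoc by blast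
      consider "c b a = 0" | "c b a = - 1" using c_off[of b a] False h less.prems(2) by auto
      then show ?thesis
      proof cases
        case 1
        have "nonneg (\<lambda>x. - wp h (\<alpha> a) x)" using less.prems(2,3) 1 snoc by (simp add: s_\<alpha>)
        then obtain v where v: "moves h (v @ [a])" using less.hyps[of h a] snoc h less.prems(2) by auto
        have "c a b = 0" using c_off[of b a] False h less.prems(2) 1 by auto
        then have "move2 c (length v + 1) (v @ [a, b]) ((v @ [b]) @ [a])"
          unfolding move2_def by (intro exI[of _ v] exI[of _ "[]"] exI[of _ a] exI[of _ b]) simp
        then have "moves w ((v @ [b]) @ [a])"
          using moves_append[OF v, of "[b]"] moves_step(1) moves_trans snoc by (metis append.assoc append_Cons append_Nil)
        then show ?thesis by blast
      next
        case 2
        have ca: "c a b = - 1" using c_off[of b a] False h less.prems(2) 2 by auto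
        have wa: "wp w (\<alpha> a) = (\<lambda>x. wp h (\<alpha> a) x + wp h (\<alpha> b) x)"
          using less.prems(2) 2 snoc by (simp add: s_\<alpha> wp_add)
        have "nonneg (\<lambda>x. - wp h (\<alpha> a) x)" unfolding nonneg_def
        proof
          fix x show "0 \<le> - wp h (\<alpha> a) x"
            using less.prems(3) hb unfolding wa nonneg_def by (smt (verit))
        qed
        then obtain v where v: "moves h (v @ [a])" using less.hyps[of h a] snoc h less.prems(2) by auto
        have rv: "reduced (v @ [a])" using moves_reduced[OF v h(1)] .
        have lv: "length v < length w" using moves_invariant[OF v h(2)] snoc by simp
        have "wp h x = wp v (s a x)" for x using moves_invariant[OF v h(2)] by (metis wp_simps)
        \<comment> \<open>As \<open>h\<close> acts by \<open>s a\<close> followed by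
          \<open>v\<close>, the image of \<open>\<alpha> b\<close> under \<open>v\<close> is that of
          \<open>\<alpha> a + \<alpha> b\<close> under \<open>h\<close>, which is the negative root
          \<open>wp w (\<alpha> a)\<close>.\<close>
        then have "wp v (\<alpha> b) = wp h (s a (\<alpha> b))" using less.prems(2) by (simp add: s_s)
        also have "\<dots> = wp w (\<alpha> a)" using wa h ca by (simp add: s_\<alpha> wp_add add.commute)
        finally have "nonneg (\<lambda>x. - wp v (\<alpha> b) x)" using less.prems(3) by simp
        then obtain u where u: "moves v (u @ [b])" using less.hyps[of v b] lv rv h reduced_appendD by blast
        have "moves w (u @ [b, a, b])"
          using moves_trans[of w "v @ [a, b]"] moves_append[OF v, of "[b]"] moves_append[OF u, of "[a, b]"]
            snoc by simp
        moreover have "move3 c (length u + 2) (u @ [b, a, b]) ((u @ [a, b]) @ [a])"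
          unfolding move3_def by (intro exI[of _ u] exI[of _ "[]"] exI[of _ b] exI[of _ a]) (simp add: ca)
        ultimately have "moves w ((u @ [a, b]) @ [a])" using moves_step(2) moves_trans by blast
        then show ?thesis by blast
      qed
    qed
  qed
qed

lemma reduced_words_iff: "w \<in> reduced_words n c g \<longleftrightarrow> reduced w \<and> wp w = g"
  by (auto simp: reduced_words_def reduced_def letters_def len_def)

text \<open>Appending a second \<open>a\<close> to \<open>w @ [a]\<close> gives back the longest
  element, so it does not shorten. Hence \<open>w @ [a]\<close> sends \<open>\<alpha> a\<close> to a
  positive root, and this is the negative of \<open>wp w (\<alpha> a)\<close>.\<close>

lemma longest_moves_to_last:
  assumes "longest_element n c w0" "w \<in> reduced_words n c w0" "a \<in> {1..n}"
  obtains v where "moves w (v @ [a])" "v @ [a] \<in> reduced_words n c w0"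
proof -
  have w: "reduced w" "letters w" "wp w = w0" using assms(2) by (auto simp: reduced_words_iff reduced_def)
  have max: "len (wp v) \<le> len (wp w)" if "letters v" for v
    using assms(1) that w(3) unfolding longest_element_def weyl_group_def len_def letters_def by auto
  have la: "letters (w @ [a])" using w assms(3) by simp
  have cancel: "wp ((w @ [a]) @ [a]) = wp w" using assms(3) by (simp add: fun_eq_iff s_s)
  have neg: "nonneg (\<lambda>x. - wp w (\<alpha> a) x)"
    using nonneg_root[OF la assms(3)] max[OF la] cancel assms(3)
    by (simp add: s_\<alpha>_self wp_minus)
  obtain v where v: "moves w (v @ [a])" using moves_to_last[OF w(1) assms(3) neg] by blast
  then have "v @ [a] \<in> reduced_words n c w0"
    using moves_reduced[OF v w(1)] moves_invariant[OF v w(2)] w(3) by (simp add: reduced_words_iff)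
  then show ?thesis using that v by blast
qed

end

section \<open>Constants and variables as rational functions\<close>

lemma rf_const_1: "rf_const 1 = 1"
  by (simp add: rf_const_def One_fract_def)

lemma single_eq_0_iff: "Poly_Mapping.single k v = 0 \<longleftrightarrow> v = 0"
  by (metis lookup_single_eq lookup_zero single_zero)

lemma rf_const_eq_0_iff [simp]: "rf_const a = 0 \<longleftrightarrow> a = 0"
  by (simp add: rf_const_def eq_fract Zero_fract_def single_eq_0_iff)

lemma rf_const_minus: "rf_const (- a) = - rf_const a"
  using rf_const_add[of a "- a"] by (simp add: rf_const_0 eq_neg_iff_add_eq_0 add.commute)

lemma rf_const_diff: "rf_const (a - b) = rf_const a - rf_const b"
  using rf_const_add[of a "- b"] by (simp add: rf_const_minus)

lemma rf_const_of_nat: "rf_const (of_nat k) = of_nat k"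
  by (induction k) (simp_all add: rf_const_0 rf_const_1 rf_const_add)

lemma rf_const_of_int: "rf_const (of_int k) = of_int k"
  by (cases k rule: int_diff_cases) (simp add: rf_const_diff rf_const_of_nat)

lemma rf_const_sum: "rf_const (sum f A) = (\<Sum>x\<in>A. rf_const (f x))"
  by (induction A rule: infinite_finite_induct) (simp_all add: rf_const_0 rf_const_add)

lemma rf_var_nonzero: "rf_var k \<noteq> 0"
  by (simp add: rf_var_def eq_fract Zero_fract_def single_eq_0_iff)

section \<open>Derivations of the field of rational functions\<close>

definition derivation :: "(ratfun \<Rightarrow> ratfun) \<Rightarrow> bool" where
  "derivation D \<longleftrightarrow> (\<forall>f g. D (f + g) = D f + D g) \<and> (\<forall>f g. D (f * g) = D f * g + f * D g) \<and>
     (\<forall>a. D (rf_const a) = 0)"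

lemma derivationD:
  assumes "derivation D"
  shows "D (f + g) = D f + D g" "D (f * g) = D f * g + f * D g" "D (rf_const a) = 0"
    "D 0 = 0" "D 1 = 0"
  using assms rf_const_0 rf_const_1 unfolding derivation_def by metis+

lemma derivation_scale: "derivation D \<Longrightarrow> D (rf_const a * f) = rf_const a * D f"
  by (simp add: derivationD)

lemma derivation_divide:
  assumes D: "derivation D" and "g \<noteq> 0"
  shows "D (f / g) = (D f * g - f * D g) / (g * g)"
proof -
  have "D f = D (f / g) * g + f / g * D g" using derivationD(2)[OF D, of "f / g" g] assms(2) by simp
  then show ?thesis using assms(2) by (simp add: field_simps)
qed

lemma derivation_divide_eigen:
  assumes D: "derivation D" and "D f = r * f" "D g = s * g" "g \<noteq> 0"
  shows "D (f / g) = (r - s) * (f / g)"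
  unfolding derivation_divide[OF D assms(4)] assms(2,3) using assms(4) by (simp add: field_simps)

lemma derivation_sum: "derivation D \<Longrightarrow> D (sum f A) = (\<Sum>x\<in>A. D (f x))"
  by (induction A rule: infinite_finite_induct) (simp_all add: derivationD)

lemma derivation_combination:
  assumes "\<And>x. x \<in> A \<Longrightarrow> derivation (E x)"
  shows "derivation (\<lambda>f. \<Sum>x\<in>A. g x * E x f)"
proof -
  have "E x (f + h) = E x f + E x h" "E x (f * h) = E x f * h + f * E x h" "E x (rf_const a) = 0"
    if "x \<in> A" for x f h a
    using derivationD[OF assms[OF that]] by blast+
  then show ?thesis
    by (simp add: derivation_def distrib_left sum.distrib sum_distrib_left sum_distrib_right ac_simps
        cong: sum.cong)
qed

text \<open>The Euler derivation \<open>x\<^sub>l \<partial>/\<partial>x\<^sub>l\<close>.\<close>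

definition poly_euler :: "nat \<Rightarrow> mpoly \<Rightarrow> mpoly" where
  "poly_euler l p = (\<Sum>m\<in>Poly_Mapping.keys p.
     Poly_Mapping.single m (of_nat (Poly_Mapping.lookup m l) * Poly_Mapping.lookup p m))"

lemma lookup_poly_euler:
  "Poly_Mapping.lookup (poly_euler l p) m = of_nat (Poly_Mapping.lookup m l) * Poly_Mapping.lookup p m"
  by (simp add: poly_euler_def lookup_sum lookup_single when_def in_keys_iff)

lemma poly_euler_add: "poly_euler l (p + q) = poly_euler l p + poly_euler l q"
  by (rule poly_mapping_eqI) (simp add: lookup_poly_euler lookup_add distrib_left)

lemma poly_euler_sum: "poly_euler l (sum f A) = (\<Sum>x\<in>A. poly_euler l (f x))"
proof (induction A rule: infinite_finite_induct)
  case empty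
  show ?case by (rule poly_mapping_eqI) (simp add: lookup_poly_euler)
next
  case (infinite A)
  then show ?case by simp (rule poly_mapping_eqI, simp add: lookup_poly_euler)
qed (simp add: poly_euler_add)

lemma poly_euler_single:
  "poly_euler l (Poly_Mapping.single m a) = Poly_Mapping.single m (of_nat (Poly_Mapping.lookup m l) * a)"
  by (rule poly_mapping_eqI) (simp add: lookup_poly_euler lookup_single when_def)

text \<open>Both sides are bilinear, and on monomials the rule says that exponents add.\<close>

lemma poly_euler_mult: "poly_euler l (p * q) = poly_euler l p * q + p * poly_euler l q"
proof -
  let ?s = "\<lambda>p m. Poly_Mapping.single m (Poly_Mapping.lookup p m)"
  let ?K = "Poly_Mapping.keys p" and ?L = "Poly_Mapping.keys q"
  have e: "poly_euler l p = (\<Sum>m\<in>Poly_Mapping.keys p. poly_euler l (?s p m))" for p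
    unfolding poly_euler_single by (rule poly_euler_def)
  have "p * q = (\<Sum>m\<in>?K. \<Sum>m'\<in>?L. ?s p m * ?s q m')"
    by (simp only: sum_product[symmetric] mpoly_sum_single[symmetric])
  then have "poly_euler l (p * q) = (\<Sum>m\<in>?K. \<Sum>m'\<in>?L. poly_euler l (?s p m * ?s q m'))"
    by (simp add: poly_euler_sum)
  also have "\<dots> = (\<Sum>m\<in>?K. \<Sum>m'\<in>?L. poly_euler l (?s p m) * ?s q m' + ?s p m * poly_euler l (?s q m'))"
    by (intro sum.cong HOL.refl)
      (simp add: poly_euler_single mult_single lookup_add ring_distribs ac_simps flip: single_add)
  also have "\<dots> = poly_euler l p * q + p * poly_euler l q"
    by (simp only: sum.distrib sum_product[symmetric] e[symmetric] mpoly_sum_single[symmetric])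
  finally show ?thesis .
qed

definition euler :: "nat \<Rightarrow> ratfun \<Rightarrow> ratfun" where
  "euler l f = (THE g. \<exists>p q. q \<noteq> 0 \<and> f = Fract p q \<and>
     g = Fract (poly_euler l p * q - p * poly_euler l q) (q * q))"

text \<open>The quotient rule does not depend on the chosen fraction: apply the Leibniz rule to
  \<open>p * q' = p' * q\<close>.\<close>

lemma euler_Fract:
  assumes "q \<noteq> 0"
  shows "euler l (Fract p q) = Fract (poly_euler l p * q - p * poly_euler l q) (q * q)"
  unfolding euler_def
proof (rule the_equality)
  fix g
  assume "\<exists>p' q'. q' \<noteq> 0 \<and> Fract p q = Fract p' q' \<and>
    g = Fract (poly_euler l p' * q' - p' * poly_euler l q') (q' * q')"
  then obtain p' q' where *: "q' \<noteq> 0" "Fract p q = Fract p' q'"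
    "g = Fract (poly_euler l p' * q' - p' * poly_euler l q') (q' * q')" by blast
  let ?a = "poly_euler l p" and ?b = "poly_euler l q" and ?a' = "poly_euler l p'" and ?b' = "poly_euler l q'"
  have pq: "p * q' = p' * q" using * assms by (simp add: eq_fract)
  then have "?a * q' + p * ?b' = ?a' * q + p' * ?b" by (metis poly_euler_mult)
  with pq have "(?a' * q' - p' * ?b') * (q * q) = (?a * q - p * ?b) * (q' * q')" by algebra
  then show "g = Fract (?a * q - p * ?b) (q * q)" using * assms by (simp add: eq_fract)
qed (use assms in blast)

lemma derivation_euler: "derivation (euler l)"
  unfolding derivation_def
proof (intro conjI allI)
  fix f g :: ratfun
  obtain p q where f: "f = Fract p q" "q \<noteq> 0" by (rule Fract_cases)
  obtain p' q' where g: "g = Fract p' q'" "q' \<noteq> 0" by (rule Fract_cases)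
  show "euler l (f + g) = euler l f + euler l g"
    using f g by (simp add: euler_Fract eq_fract poly_euler_add poly_euler_mult) (simp add: algebra_simps)
  show "euler l (f * g) = euler l f * g + f * euler l g"
    using f g by (simp add: euler_Fract eq_fract poly_euler_mult) (simp add: algebra_simps)
next
  fix a
  have 1: "poly_euler l 1 = 0"
    by (rule poly_mapping_eqI) (simp add: lookup_poly_euler lookup_one when_def)
  show "euler l (rf_const a) = 0"
    by (simp add: rf_const_def euler_Fract 1 poly_euler_single fract_collapse)
qed

lemma euler_var: "euler l (rf_var k) = (if k = l then rf_var k else 0)"
proof -
  have 1: "poly_euler l 1 = 0"
    by (rule poly_mapping_eqI) (simp add: lookup_poly_euler lookup_one when_def)
  show ?thesis
    by (simp add: rf_var_def euler_Fract 1 poly_euler_single lookup_single when_def fract_collapse)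
qed

section \<open>Laurent monomials\<close>

definition lmon :: "(nat \<Rightarrow>\<^sub>0 int) \<Rightarrow> ratfun" where
  "lmon u = (\<Prod>k\<in>Poly_Mapping.keys u. rf_var k powi Poly_Mapping.lookup u k)"

lemma laurent_to_rf_eq:
  "laurent_to_rf F = (\<Sum>u\<in>Poly_Mapping.keys F. rf_const (Poly_Mapping.lookup F u) * lmon u)"
  by (simp add: laurent_to_rf_def lmon_def)

lemma lmon_superset:
  assumes "finite B" "Poly_Mapping.keys u \<subseteq> B"
  shows "lmon u = (\<Prod>k\<in>B. rf_var k powi Poly_Mapping.lookup u k)"
  unfolding lmon_def using assms by (intro prod.mono_neutral_left) (auto simp: in_keys_iff)

lemma lmon_0 [simp]: "lmon 0 = 1"
  by (simp add: lmon_def)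

lemma lmon_add: "lmon (u + v) = lmon u * lmon v"
proof -
  let ?B = "Poly_Mapping.keys u \<union> Poly_Mapping.keys v"
  have "lmon (u + v) = (\<Prod>k\<in>?B. rf_var k powi Poly_Mapping.lookup (u + v) k)"
    by (intro lmon_superset Poly_Mapping.keys_add) simp
  also have "\<dots> = lmon u * lmon v"
    by (simp add: lmon_superset[of ?B u] lmon_superset[of ?B v] lookup_add power_int_add rf_var_nonzero
        prod.distrib)
  finally show ?thesis .
qed

lemma lmon_nonzero: "lmon u \<noteq> 0"
  by (simp add: lmon_def rf_var_nonzero)

lemma derivation_power_int:
  assumes D: "derivation D" and E: "D f = r * f" and f: "f \<noteq> 0"
  shows "D (f powi k) = of_int k * r * f powi k"
proof -
  have pow: "D (f ^ m) = of_nat m * r * f ^ m" for m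
    by (induction m) (simp_all add: derivationD[OF D] E algebra_simps)
  show ?thesis
  proof (cases k)
    case (nonneg m)
    then show ?thesis by (simp add: pow)
  next
    case (neg m)
    have nz: "f ^ Suc m \<noteq> 0" using f by simp
    have "D (1 / f ^ Suc m) = - (of_nat (Suc m) * r) / f ^ Suc m"
      unfolding derivation_divide[OF D nz] derivationD(5)[OF D] pow
      using nz by (simp add: field_simps del: power_Suc of_nat_Suc)
    moreover have "of_int k = - (of_nat (Suc m) :: ratfun)"
      using neg by (simp only: of_int_minus of_int_of_nat_eq)
    then have "- (of_nat (Suc m) * r) = of_int k * r" by (simp only: mult_minus_left)
    moreover have "f powi k = 1 / f ^ Suc m"
      using neg by (simp only: power_int_minus power_int_of_nat inverse_eq_divide)
    ultimately show ?thesis by (simp only: times_divide_eq_right mult_1_right)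
  qed
qed

lemma derivation_prod_eigen:
  assumes D: "derivation D" and "\<And>x. x \<in> A \<Longrightarrow> D (f x) = r x * f x"
  shows "D (prod f A) = sum r A * prod f A"
  using assms(2)
  by (induction A rule: infinite_finite_induct) (simp_all add: derivationD[OF D] algebra_simps)

lemma euler_lmon: "euler l (lmon u) = of_int (Poly_Mapping.lookup u l) * lmon u"
proof -
  have "euler l (lmon u) = (\<Sum>k\<in>Poly_Mapping.keys u. if k = l then of_int (Poly_Mapping.lookup u k) else 0) * lmon u"
    unfolding lmon_def
  proof (rule derivation_prod_eigen[OF derivation_euler])
    fix k
    have "euler l (rf_var k) = (if k = l then 1 else 0) * rf_var k" by (simp add: euler_var)
    from derivation_power_int[OF derivation_euler this rf_var_nonzero]
    show "euler l (rf_var k powi Poly_Mapping.lookup u k) =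
      (if k = l then of_int (Poly_Mapping.lookup u k) else 0) * rf_var k powi Poly_Mapping.lookup u k"
      by simp
  qed
  then show ?thesis by (simp add: in_keys_iff)
qed

text \<open>Distinct Laurent monomials are separated by their eigenvalues under the Euler derivations.\<close>

lemma lmon_independent:
  "finite A \<Longrightarrow> (\<Sum>u\<in>A. rf_const (a u) * lmon u) = 0 \<Longrightarrow> u \<in> A \<Longrightarrow> a u = 0"
proof (induction A arbitrary: a u rule: finite_induct)
  case (insert v A)
  let ?L = "Poly_Mapping.lookup"
  have sum0: "rf_const (a v) * lmon v + (\<Sum>u\<in>A. rf_const (a u) * lmon u) = 0"
    using insert by simp
  have A0: "a w = 0" if w: "w \<in> A" for w
  proof -
    have "w \<noteq> v" using w insert by auto
    then obtain l where l: "?L w l \<noteq> ?L v l" by (meson poly_mapping_eqI)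
    have e: "euler l (rf_const b * lmon x) = rf_const (b * of_int (?L x l)) * lmon x" for b x
      by (simp add: derivationD[OF derivation_euler] euler_lmon rf_const_mult rf_const_of_int)
    \<comment> \<open>Apply \<open>euler l\<close> to the relation and subtract the relation
      multiplied by the eigenvalue at \<open>v\<close>: the term of \<open>v\<close> drops out, and
      that of \<open>w\<close> keeps a nonzero factor.\<close>
    have "euler l (rf_const (a v) * lmon v + (\<Sum>u\<in>A. rf_const (a u) * lmon u)) = 0"
      unfolding sum0 by (rule derivationD(4)[OF derivation_euler])
    then have e1: "rf_const (a v * of_int (?L v l)) * lmon v + (\<Sum>u\<in>A. rf_const (a u * of_int (?L u l)) * lmon u) = 0"
      by (simp add: derivationD(1)[OF derivation_euler] derivation_sum[OF derivation_euler] e)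
    have "rf_const (of_int (?L v l)) * (rf_const (a v) * lmon v + (\<Sum>u\<in>A. rf_const (a u) * lmon u)) = 0"
      unfolding sum0 by simp
    then have e2: "rf_const (a v * of_int (?L v l)) * lmon v + (\<Sum>u\<in>A. rf_const (a u * of_int (?L v l)) * lmon u) = 0"
      by (simp add: distrib_left sum_distrib_left rf_const_mult ac_simps)
    have "(\<Sum>u\<in>A. rf_const (a u * of_int (?L u l)) * lmon u) =
        (\<Sum>u\<in>A. rf_const (a u * of_int (?L v l)) * lmon u)"
      by (rule add_left_imp_eq[OF trans[OF e1 e2[symmetric]]])
    then have "(\<Sum>u\<in>A. rf_const (a u * of_int (?L u l) - a u * of_int (?L v l)) * lmon u) = 0"
      by (simp add: rf_const_diff left_diff_distrib sum_subtractf)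
    from insert.IH[OF this w] show ?thesis using l by (simp flip: right_diff_distrib of_int_diff)
  qed
  then have "rf_const (a v) * lmon v = 0" using sum0 by (simp add: rf_const_0)
  then have "a v = 0" using lmon_nonzero by simp
  then show ?case using A0 insert by blast
qed simp

section \<open>Subtraction-free rational functions\<close>

text \<open>For complex numbers \<open>0 \<le> z\<close> says that \<open>z\<close> is a nonnegative
  real. Sums of such polynomials cannot cancel, which keeps the denominators of the transition maps
  nonzero.\<close>

definition pos_poly :: "mpoly \<Rightarrow> bool" where
  "pos_poly p \<longleftrightarrow> p \<noteq> 0 \<and> (\<forall>m. 0 \<le> Poly_Mapping.lookup p m)"

lemma pos_poly_add: "pos_poly p \<Longrightarrow> pos_poly q \<Longrightarrow> pos_poly (p + q)"
proof -
  assume p: "pos_poly p" and q: "pos_poly q"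
  have "p + q \<noteq> 0"
  proof
    assume "p + q = 0"
    then have "Poly_Mapping.lookup p m + Poly_Mapping.lookup q m = 0" for m by (metis lookup_add lookup_zero)
    then have "Poly_Mapping.lookup p m = 0" for m
      using p q unfolding pos_poly_def by (metis add_nonneg_eq_0_iff)
    then show False using p poly_mapping_eqI[of p 0] by (auto simp: pos_poly_def)
  qed
  then show ?thesis using p q by (simp add: pos_poly_def lookup_add)
qed

lemma pos_poly_mult: "pos_poly p \<Longrightarrow> pos_poly q \<Longrightarrow> pos_poly (p * q)"
proof -
  assume p: "pos_poly p" and q: "pos_poly q"
  let ?s = "\<lambda>p m. Poly_Mapping.single m (Poly_Mapping.lookup p m)"
  have pq: "p * q = (\<Sum>m\<in>Poly_Mapping.keys p. \<Sum>m'\<in>Poly_Mapping.keys q. ?s p m * ?s q m')"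
    by (simp only: sum_product[symmetric] mpoly_sum_single[symmetric])
  have "0 \<le> Poly_Mapping.lookup (p * q) m" for m
    unfolding pq using p q
    by (auto simp: lookup_sum mult_single lookup_single when_def pos_poly_def intro!: sum_nonneg)
  then show ?thesis using p q by (simp add: pos_poly_def)
qed

definition rf_pos :: "ratfun \<Rightarrow> bool" where
  "rf_pos f \<longleftrightarrow> (\<exists>p q. f = Fract p q \<and> pos_poly p \<and> pos_poly q)"

lemma rf_pos_nonzero: "rf_pos f \<Longrightarrow> f \<noteq> 0"
  by (auto simp: rf_pos_def pos_poly_def eq_fract Zero_fract_def)

lemma rf_pos_closed:
  assumes "rf_pos f" "rf_pos g"
  shows "rf_pos (f + g)" "rf_pos (f * g)" "rf_pos (f / g)"
proof -
  obtain p q p' q' where *: "f = Fract p q" "g = Fract p' q'" "pos_poly p" "pos_poly q" "pos_poly p'" "pos_poly q'"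
    using assms by (auto simp: rf_pos_def)
  then have "q \<noteq> 0" "q' \<noteq> 0" by (auto simp: pos_poly_def)
  then have "f + g = Fract (p * q' + p' * q) (q * q')" "f * g = Fract (p * p') (q * q')"
    "f / g = Fract (p * q') (q * p')" using * by simp_all
  then show "rf_pos (f + g)" "rf_pos (f * g)" "rf_pos (f / g)"
    unfolding rf_pos_def using * pos_poly_add pos_poly_mult by blast+
qed

lemma rf_pos_var: "rf_pos (rf_var k)"
  unfolding rf_pos_def rf_var_def
  by (intro exI conjI, rule HOL.refl)
    (auto simp: pos_poly_def lookup_single lookup_one when_def single_eq_0_iff less_eq_complex_def)

section \<open>Vector fields in the charts of different words\<close>

context simply_laced_matrix
begin

text \<open>A word together with the coordinates belonging to its letters is a list of pairs.\<close>

fun tail_prod :: "nat \<Rightarrow> (nat \<times> ratfun) list \<Rightarrow> ratfun" where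
  "tail_prod b [] = 1"
| "tail_prod b ((x, y) # zs) = y powi (- c x b) * tail_prod b zs"

text \<open>If \<open>w\<close> is the part of a reduced word behind a letter \<open>x\<close>, this
  is the positive root attached to that position: the inverse of \<open>w\<close> applied to
  \<open>\<alpha> x\<close>.\<close>

definition root :: "nat list \<Rightarrow> nat \<Rightarrow> nat \<Rightarrow> int" where
  "root w x = wp (rev w) (\<alpha> x)"

lemma root_Cons: "x \<in> {1..n} \<Longrightarrow> root (y # w) x b = root w x b - c y x * root w y b"
proof -
  assume "x \<in> {1..n}"
  then have "s y (\<alpha> x) = (\<lambda>z. \<alpha> x z + (- c y x) * \<alpha> y z)" by (simp add: s_\<alpha>)
  then show ?thesis
    using wp_add[of "rev w" "\<alpha> x" "\<lambda>z. - c y x * \<alpha> y z"] wp_mult[of "rev w" "- c y x" "\<alpha> y"]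
    by (simp add: root_def)
qed

text \<open>Unfolds \<open>root_Cons\<close> letter by letter. The recursion later gives the degree
  of \<open>\<zeta> l\<close>.\<close>

lemma root_sum:
  "letters w \<Longrightarrow> x \<in> {1..n} \<Longrightarrow>
   root w x b = \<alpha> x b - (\<Sum>q<length w. c (w ! q) x * root (drop (Suc q) w) (w ! q) b)"
proof (induction w)
  case (Cons y w)
  then show ?case by (simp add: root_Cons sum.lessThan_Suc_shift del: sum.lessThan_Suc)
qed (simp add: root_def)

lemma root_nonneg:
  assumes "reduced (w' @ x # w)"
  shows "0 \<le> root w x b"
proof -
  have "reduced ((rev w @ [x]) @ rev w')" using reduced_rev[OF assms] by simp
  then have "nonneg (wp (rev w) (\<alpha> x))" using reduced_appendD reduced_snoc_nonneg by blast
  then show ?thesis by (simp add: nonneg_def root_def)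
qed

text \<open>Coordinates are counted from 1 and list entries from 0, hence the
  \<open>Suc\<close>.\<close>

definition pairs :: "nat list \<Rightarrow> (nat \<Rightarrow> ratfun) \<Rightarrow> (nat \<times> ratfun) list" where
  "pairs j \<Phi> = map (\<lambda>q. (j ! q, \<Phi> (Suc q))) [0..<length j]"

lemma pairs_append:
  "pairs (us @ vs) \<Phi> = pairs us \<Phi> @ pairs vs (\<lambda>q. \<Phi> (q + length us))"
proof (rule nth_equalityI)
  fix r assume "r < length (pairs (us @ vs) \<Phi>)"
  then show "pairs (us @ vs) \<Phi> ! r = (pairs us \<Phi> @ pairs vs (\<lambda>q. \<Phi> (q + length us))) ! r"
    by (auto simp: pairs_def nth_append)
qed (simp add: pairs_def)

lemma pairs_Cons: "pairs (x # vs) \<Phi> = (x, \<Phi> 1) # pairs vs (\<lambda>q. \<Phi> (q + 1))"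
  using pairs_append[of "[x]" vs \<Phi>] by (simp add: pairs_def)

lemma pairs_cong: "(\<And>q. 1 \<le> q \<Longrightarrow> q \<le> length j \<Longrightarrow> \<Phi> q = \<Psi> q) \<Longrightarrow> pairs j \<Phi> = pairs j \<Psi>"
  by (simp add: pairs_def)

lemma pairs_move2:
  "pairs (us @ [a, b] @ vs) \<Phi> = pairs us \<Phi> @ [(a, \<Phi> (length us + 1)), (b, \<Phi> (length us + 2))] @
     pairs vs (\<lambda>q. \<Phi> (q + (length us + 2)))"
  by (simp add: pairs_append pairs_Cons add.commute add.left_commute)

lemma pairs_move3:
  "pairs (us @ [a, b, a] @ vs) \<Phi> = pairs us \<Phi> @
     [(a, \<Phi> (length us + 1)), (b, \<Phi> (length us + 2)), (a, \<Phi> (length us + 3))] @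
     pairs vs (\<lambda>q. \<Phi> (q + (length us + 3)))"
  by (simp add: pairs_append pairs_Cons numeral_3_eq_3 add.commute add.left_commute)

lemma map_fst_pairs [simp]: "map fst (pairs w \<Phi>) = w"
  by (simp add: pairs_def comp_def map_nth)

lemma tail_prod_pairs:
  "tail_prod b (pairs w \<Phi>) = (\<Prod>q<length w. \<Phi> (Suc q) powi (- c (w ! q) b))"
  by (induction w arbitrary: \<Phi>)
    (simp_all add: pairs_Cons prod.lessThan_Suc_shift pairs_def[of "[]"] del: prod.lessThan_Suc)

lemma moves_transition: "moves i j \<Longrightarrow> \<exists>\<Phi>. transition c i j \<Phi>"
  unfolding moves_def
  by (induction rule: rtranclp_induct) (blast intro: transition.intros)+

end

section \<open>Vector fields and degrees under moves\<close>

locale flow = simply_laced_matrix +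
  fixes \<Theta> \<Delta> :: "nat \<Rightarrow> ratfun \<Rightarrow> ratfun" and K :: "(ratfun \<Rightarrow> ratfun) set"
  assumes der_\<Theta>: "derivation (\<Theta> b)" and der_\<Delta>: "derivation (\<Delta> b)"
    and der_K: "E \<in> K \<Longrightarrow> derivation E"
begin

text \<open>The form that \<Theta> and \<Delta> take in every chart: the speed of a coordinate is
  the tail product behind it, its degree the root of its position. \<open>K\<close> will consist of
  the Euler derivations of the variables outside the chart. Positivity keeps the denominators in
  \<open>psi3\<close> nonzero.\<close>

fun compatible :: "(nat \<times> ratfun) list \<Rightarrow> bool" where
  "compatible [] \<longleftrightarrow> True"
| "compatible ((x, y) # zs) \<longleftrightarrow> rf_pos y \<and>
     (\<forall>b\<in>{1..n}. \<Theta> b y = (if x = b then tail_prod b zs else 0)) \<and>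
     (\<forall>b\<in>{1..n}. \<Delta> b y = of_int (root (map fst zs) x b) * y) \<and>
     (\<forall>E\<in>K. E y = 0) \<and> compatible zs"

text \<open>Records all that the conditions on an earlier letter see of the list behind it, so a
  suffix may be exchanged for an equivalent one.\<close>

definition tail_eq :: "(nat \<times> ratfun) list \<Rightarrow> (nat \<times> ratfun) list \<Rightarrow> bool" where
  "tail_eq zs zs' \<longleftrightarrow> (\<forall>b\<in>{1..n}. tail_prod b zs = tail_prod b zs') \<and>
     wp (rev (map fst zs)) = wp (rev (map fst zs'))"

lemma compatible_append:
  assumes "tail_eq zs zs'" "compatible zs'"
  shows "compatible (us @ zs) \<Longrightarrow> compatible (us @ zs') \<and> tail_eq (us @ zs) (us @ zs')"
proof (induction us)
  case (Cons u us)
  obtain x y where u: "u = (x, y)" by fastforce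
  have IH: "compatible (us @ zs')" "tail_eq (us @ zs) (us @ zs')" using Cons u by auto
  then have "root (map fst (us @ zs)) x = root (map fst (us @ zs')) x" by (simp only: root_def tail_eq_def)
  moreover have "tail_prod b (us @ zs) = tail_prod b (us @ zs')" if "b \<in> {1..n}" for b
    using IH that by (simp add: tail_eq_def)
  ultimately have "compatible ((u # us) @ zs')" using Cons.prems IH(1) u by simp
  moreover have "tail_eq ((u # us) @ zs) ((u # us) @ zs')"
    using IH(2) u by (auto simp: tail_eq_def fun_eq_iff)
  ultimately show ?case by blast
qed (use assms in auto)

lemma compatible_appendD: "compatible (us @ zs) \<Longrightarrow> compatible zs"
  by (induction us) auto

text \<open>Neither of the two letters enters the tail product or the root of the other.\<close>

lemma compatible_move2:
  assumes ab: "a \<in> {1..n}" "b \<in> {1..n}" "c a b = 0"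
    and "compatible (us @ [(a, A), (b, B)] @ vs)"
  shows "compatible (us @ [(b, B), (a, A)] @ vs)"
proof -
  have ne: "a \<noteq> b" using ab c_diag[of a] by auto
  then have ba: "c b a = 0" using ab c_off[of a b] by auto
  have eq: "tail_eq ([(a, A), (b, B)] @ vs) ([(b, B), (a, A)] @ vs)"
    by (simp add: tail_eq_def fun_eq_iff s_commute[OF ab])
  have "compatible ([(a, A), (b, B)] @ vs)" using assms(4) by (rule compatible_appendD)
  then have "compatible ([(b, B), (a, A)] @ vs)"
    using ab ne ba by (auto simp: root_def s_\<alpha>)
  then show ?thesis using compatible_append[OF eq] assms(4) by blast
qed

lemma compatible_move3:
  assumes ab: "a \<in> {1..n}" "b \<in> {1..n}" "c b a = - 1"
    and "compatible (us @ [(a, A), (b, B), (a, C)] @ vs)"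
  shows "compatible (us @ [(b, B * C / (B + A * C)), (a, A * C), (b, A + B / C)] @ vs)"
proof -
  let ?A = "B * C / (B + A * C)" and ?B = "A * C" and ?C = "A + B / C"
  let ?zs = "[(a, A), (b, B), (a, C)] @ vs" and ?zs' = "[(b, ?A), (a, ?B), (b, ?C)] @ vs"
  have ne: "a \<noteq> b" using ab c_diag[of a] by auto
  then have cc: "c a b = - 1" using ab c_off[of a b] by auto
  have comp: "compatible ?zs" using assms(4) by (rule compatible_appendD)
  then have pos: "rf_pos A" "rf_pos B" "rf_pos C" by auto
  then have pos': "rf_pos ?A" "rf_pos ?B" "rf_pos ?C" by (simp_all add: rf_pos_closed)
  have nz: "A \<noteq> 0" "B \<noteq> 0" "C \<noteq> 0" "?C \<noteq> 0" using pos pos' rf_pos_nonzero by blast+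
  \<comment> \<open>For each of the two letters the product of its coordinates is the same before
    and after the move: \<open>?A * ?C = B\<close> and \<open>?B = A * C\<close>. This makes the
    tail products agree.\<close>
  have A': "?A = B / ?C" using nz by (simp add: field_simps)
  have 2: "y powi (- 2) = 1 / (y * y)" for y :: ratfun
    by (simp add: power_int_minus power2_eq_square inverse_eq_divide)
  have eq: "tail_eq ?zs ?zs'"
    unfolding tail_eq_def
  proof (intro conjI ballI)
    fix e assume "e \<in> {1..n}"
    have AC: "B = ?A * ?C" using nz by (simp add: A')
    have "tail_prod e ?zs = (A * C) powi (- c a e) * B powi (- c b e) * tail_prod e vs"
      by (simp add: power_int_mult_distrib)
    also have "B powi (- c b e) = ?A powi (- c b e) * ?C powi (- c b e)"
      by (subst AC) (rule power_int_mult_distrib)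
    finally show "tail_prod e ?zs = tail_prod e ?zs'" by (simp add: ac_simps)
  qed (simp add: fun_eq_iff s_braid[OF ab(2,1,3)])
  \<comment> \<open>From left to right the three roots are \<open>Z\<close>, \<open>X + Z\<close>,
    \<open>X\<close> before the move and appear in the opposite order after it.\<close>
  define X where "X = root (map fst vs) a"
  define Z where "Z = root (map fst vs) b"
  have roots: "root (map fst vs) a = X" "root (a # map fst vs) b = (\<lambda>e. X e + Z e)"
    "root (b # a # map fst vs) a = Z" "root (map fst vs) b = Z" "root (b # map fst vs) a = (\<lambda>e. X e + Z e)"
    "root (a # b # map fst vs) b = X"
    using ab cc c_diag[of a] c_diag[of b]
    by (simp_all add: X_def Z_def root_def s_\<alpha> s_add wp_add add.commute wp_minus s_\<alpha>_self)
  have "compatible vs" using comp by simp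
  moreover have "\<Theta> e ?A = (if b = e then tail_prod e ([(a, ?B), (b, ?C)] @ vs) else 0) \<and>
      \<Theta> e ?B = (if a = e then tail_prod e ([(b, ?C)] @ vs) else 0) \<and>
      \<Theta> e ?C = (if b = e then tail_prod e vs else 0)" if e: "e \<in> {1..n}" for e
  proof -
    let ?P = "tail_prod e vs"
    note D = derivationD[OF der_\<Theta>[of e]] derivation_divide[OF der_\<Theta>[of e]]
    have \<Theta>: "\<Theta> e A = (if a = e then B powi (- c b e) * (C powi (- c a e) * ?P) else 0)"
      "\<Theta> e B = (if b = e then C powi (- c a e) * ?P else 0)" "\<Theta> e C = (if a = e then ?P else 0)"
      using comp e by auto
    consider "e = a" | "e = b" | "e \<noteq> a" "e \<noteq> b" by blast
    then show ?thesis
    proof cases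
      case 1
      have t: "\<Theta> e A = B / (C * C) * ?P" "\<Theta> e B = 0" "\<Theta> e C = ?P"
        unfolding \<Theta> using 1 ne ab c_diag[of a] by (simp_all add: 2)
      \<comment> \<open>The changes of \<open>A\<close> and of \<open>B / C\<close> cancel.\<close>
      have C0: "\<Theta> e ?C = 0" using nz by (simp add: D t field_simps)
      have "\<Theta> e ?A = 0" unfolding A' using nz(4) C0 by (simp add: D(6) t)
      moreover have "\<Theta> e ?B = ?C * ?P" using nz by (simp add: D t field_simps)
      ultimately show ?thesis using C0 1 ne ab by simp
    next
      case 2
      have t: "\<Theta> e A = 0" "\<Theta> e B = C * ?P" "\<Theta> e C = 0"
        unfolding \<Theta> using 2 ne cc by simp_all
      have CP: "\<Theta> e ?C = ?P" using nz by (simp add: D t)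
      have "\<Theta> e ?A = (C * ?P * ?C - B * ?P) / (?C * ?C)" unfolding A' using nz(4) CP by (simp add: D(6) t)
      also have "C * ?P * ?C - B * ?P = ?B * ?P" using nz by (simp add: field_simps)
      finally have "\<Theta> e ?A = ?B * ?P / (?C * ?C)" .
      moreover have "\<Theta> e ?B = 0" by (simp add: D t)
      ultimately show ?thesis using CP 2 ne cc ab c_diag[of b] \<open>\<And>y. y powi (- 2) = 1 / (y * y)\<close> by simp
    next
      case 3
      then have "\<Theta> e A = 0" "\<Theta> e B = 0" "\<Theta> e C = 0" using \<Theta> by auto
      then have "\<Theta> e ?C = 0" "\<Theta> e ?B = 0" using nz by (simp_all add: D)
      moreover from this \<open>\<Theta> e B = 0\<close> have "\<Theta> e ?A = 0" unfolding A' using nz(4) by (simp add: D(6))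
      ultimately show ?thesis using 3 by simp
    qed
  qed
  moreover have "\<Delta> e ?A = of_int (root (map fst ([(a, ?B), (b, ?C)] @ vs)) b e) * ?A \<and>
      \<Delta> e ?B = of_int (root (map fst ([(b, ?C)] @ vs)) a e) * ?B \<and>
      \<Delta> e ?C = of_int (root (map fst vs) b e) * ?C" if e: "e \<in> {1..n}" for e
  proof -
    note D = derivationD[OF der_\<Delta>[of e]] derivation_divide[OF der_\<Delta>[of e]]
    have t: "\<Delta> e A = of_int (Z e) * A" "\<Delta> e B = of_int (X e + Z e) * B" "\<Delta> e C = of_int (X e) * C"
      using comp e by (auto simp: roots)
    have CZ: "\<Delta> e ?C = of_int (Z e) * ?C" using nz by (simp add: D t field_simps)
    have "\<Delta> e ?A = of_int (X e) * ?A" unfolding A'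
      using derivation_divide_eigen[OF der_\<Delta> t(2) CZ nz(4)] by simp
    moreover have "\<Delta> e ?B = of_int (X e + Z e) * ?B" by (simp add: D t algebra_simps)
    ultimately show ?thesis using CZ by (simp add: roots)
  qed
  moreover have "E ?A = 0 \<and> E ?B = 0 \<and> E ?C = 0" if E: "E \<in> K" for E
  proof -
    note D = derivationD[OF der_K[OF E]] derivation_divide[OF der_K[OF E]]
    have t: "E A = 0" "E B = 0" "E C = 0" using comp E by auto
    then have "E ?C = 0" "E ?B = 0" using nz by (simp_all add: D)
    moreover from this t have "E ?A = 0" unfolding A' using nz(4) by (simp add: D(6))
    ultimately show ?thesis by blast
  qed
  ultimately have "compatible ?zs'" using pos' by simp
  then show ?thesis using compatible_append[OF eq] assms(4) by blast
qed

lemma transition_compatible: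
  "transition c i j \<Phi> \<Longrightarrow> letters i \<Longrightarrow> compatible (pairs i rf_var) \<Longrightarrow> letters j \<and> compatible (pairs j \<Phi>)"
proof (induction rule: transition.induct)
  case (move2 i j \<Phi> k j')
  then obtain us vs a b where *: "j = us @ [a, b] @ vs" "j' = us @ [b, a] @ vs" "k = length us + 1" "c a b = 0"
    unfolding move2_def by blast
  have us: "pairs us (psi2 k \<Phi>) = pairs us \<Phi>" by (rule pairs_cong) (simp add: psi2_def *(3))
  have vs: "pairs vs (\<lambda>q. psi2 k \<Phi> (q + (length us + 2))) = pairs vs (\<lambda>q. \<Phi> (q + (length us + 2)))"
    by (rule pairs_cong) (simp add: psi2_def *(3))
  have l: "letters j" "compatible (pairs j \<Phi>)" using move2 by auto
  then have "a \<in> {1..n}" "b \<in> {1..n}" "letters j'" by (auto simp: *)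
  moreover have "compatible (pairs j' (psi2 k \<Phi>))"
    using compatible_move2[OF calculation(1,2) *(4) l(2)[unfolded *(1) pairs_move2]]
    unfolding *(2) pairs_move2 us vs by (simp add: psi2_def *(3))
  ultimately show ?case by blast
next
  case (move3 i j \<Phi> k j')
  then obtain us vs a b where *: "j = us @ [a, b, a] @ vs" "j' = us @ [b, a, b] @ vs" "k = length us + 2" "c b a = - 1"
    unfolding move3_def by blast
  have us: "pairs us (psi3 k \<Phi>) = pairs us \<Phi>" by (rule pairs_cong) (simp add: psi3_def *(3))
  have vs: "pairs vs (\<lambda>q. psi3 k \<Phi> (q + (length us + 3))) = pairs vs (\<lambda>q. \<Phi> (q + (length us + 3)))"
    by (rule pairs_cong) (simp add: psi3_def *(3))
  have l: "letters j" "compatible (pairs j \<Phi>)" using move3 by auto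
  then have "a \<in> {1..n}" "b \<in> {1..n}" "letters j'" by (auto simp: *)
  moreover have "compatible (pairs j' (psi3 k \<Phi>))"
    using compatible_move3[OF calculation(1,2) *(4) l(2)[unfolded *(1) pairs_move3]]
    unfolding *(2) pairs_move3 us vs by (simp add: psi3_def *(3) numeral_3_eq_3)
  ultimately show ?case by blast
qed simp

end

section \<open>Exponents between -1 and 1\<close>

text \<open>Exponents are plain functions here, \<open>C u\<close> is the coefficient at
  \<open>u\<close>, and \<open>dg u\<close> is the letter whose simple root is the degree of
  \<open>u\<close>. \<open>relation\<close> is the coefficient at \<open>w\<close> of the equation
  for \<open>\<Theta> b\<close>; the factor \<open>w l + 1\<close> is the exponent of the
  \<open>l\<close>-th variable in \<open>w - \<zeta> l\<close>. \<open>has_pos\<close> reflects that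
  a simple root is not a nonpositive combination of the attached positive roots.\<close>

locale exponent_system =
  fixes N :: nat and \<iota> :: "nat \<Rightarrow> nat" and c :: "nat \<Rightarrow> nat \<Rightarrow> int"
    and C :: "(nat \<Rightarrow> int) \<Rightarrow> complex" and \<zeta> :: "nat \<Rightarrow> nat \<Rightarrow> int"
    and dg :: "(nat \<Rightarrow> int) \<Rightarrow> nat"
  assumes \<zeta>_def: "\<zeta> l p = (if p = l then - 1 else if l < p \<and> p \<le> N then - c (\<iota> p) (\<iota> l) else 0)"
    and diag: "l \<in> {1..N} \<Longrightarrow> c (\<iota> l) (\<iota> l) = 2"
    and off_diag: "l \<in> {1..N} \<Longrightarrow> q \<in> {1..N} \<Longrightarrow> \<iota> l \<noteq> \<iota> q \<Longrightarrow>
      c (\<iota> l) (\<iota> q) = c (\<iota> q) (\<iota> l) \<and> c (\<iota> l) (\<iota> q) \<in> {0, - 1}"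
    and outside: "C u \<noteq> 0 \<Longrightarrow> l \<notin> {1..N} \<Longrightarrow> u l = 0"
    and finite_support: "finite {u. C u \<noteq> 0}"
    and bound: "C u \<noteq> 0 \<Longrightarrow> \<bar>u l\<bar> \<le> 1"
    and relation: "b \<in> \<iota> ` {1..N} \<Longrightarrow> w \<noteq> (\<lambda>_. 0) \<Longrightarrow>
      (\<Sum>l\<in>{l\<in>{1..N}. \<iota> l = b}. of_int (w l + 1) * C (\<lambda>p. w p - \<zeta> l p)) = 0"
    and has_pos: "C u \<noteq> 0 \<Longrightarrow> \<exists>l. u l = 1"
    and dg_shift: "l \<in> {1..N} \<Longrightarrow> l' \<in> {1..N} \<Longrightarrow> \<iota> l = \<iota> l' \<Longrightarrow> C u \<noteq> 0 \<Longrightarrow>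
      C (\<lambda>p. u p + \<zeta> l p - \<zeta> l' p) \<noteq> 0 \<Longrightarrow> dg (\<lambda>p. u p + \<zeta> l p - \<zeta> l' p) = dg u"
    and dg_top: "l \<in> {1..N} \<Longrightarrow> C (\<lambda>p. - \<zeta> l p) \<noteq> 0 \<Longrightarrow> dg (\<lambda>p. - \<zeta> l p) = \<iota> l"
begin

section \<open>Exchanges between occurrences of one letter\<close>

lemma bounds: "C u \<noteq> 0 \<Longrightarrow> u l \<le> 1" "C u \<noteq> 0 \<Longrightarrow> - 1 \<le> u l"
  using bound[of u l] by auto

lemma \<zeta>_same: "l \<in> {1..N} \<Longrightarrow> p \<in> {1..N} \<Longrightarrow> \<iota> p = \<iota> l \<Longrightarrow>
    \<zeta> l p = (if p = l then - 1 else if l < p then - 2 else 0)"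
  using diag[of l] by (auto simp: \<zeta>_def)

text \<open>In the relation at \<open>u + \<zeta> l\<close> the term of \<open>l\<close> is
  \<open>u l * C u\<close>, which is nonzero, so some other term must be nonzero too.\<close>

lemma partner:
  assumes "C u \<noteq> 0" "l \<in> {1..N}" "u l \<noteq> 0" "u \<noteq> (\<lambda>p. - \<zeta> l p)"
  obtains l' where "l' \<in> {1..N}" "l' \<noteq> l" "\<iota> l' = \<iota> l"
    "C (\<lambda>p. u p + \<zeta> l p - \<zeta> l' p) \<noteq> 0" "u l' + \<zeta> l l' + 1 \<noteq> 0"
proof -
  let ?L = "{q\<in>{1..N}. \<iota> q = \<iota> l}"
  let ?w = "\<lambda>p. u p + \<zeta> l p"
  let ?t = "\<lambda>q. of_int (?w q + 1) * C (\<lambda>p. ?w p - \<zeta> q p)"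
  have "?w \<noteq> (\<lambda>_. 0)"
  proof
    assume "?w = (\<lambda>_. 0)"
    then have "u p = - \<zeta> l p" for p by (metis add_eq_0_iff2)
    then show False using assms(4) by blast
  qed
  moreover have "\<iota> l \<in> \<iota> ` {1..N}" using assms(2) by blast
  ultimately have sum0: "sum ?t ?L = 0" by (rule relation[rotated])
  have "?t l \<noteq> 0" using assms(1,3) by (simp add: \<zeta>_def)
  moreover have "sum ?t ?L = ?t l + sum ?t (?L - {l})"
    using assms(2) by (intro sum.remove) auto
  ultimately have "sum ?t (?L - {l}) \<noteq> 0" using sum0 by auto
  then obtain l' where l': "l' \<in> ?L - {l}" "?t l' \<noteq> 0" by (meson sum.neutral)
  moreover have "?w l' + 1 \<noteq> 0" using l'(2) by (metis mult_zero_left of_int_0)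
  ultimately show ?thesis using that[of l'] by auto
qed

text \<open>The bound decides everything. A partner behind \<open>h\<close> would leave the entry -2
  at \<open>h\<close>, so \<open>j < h\<close>. The entry at \<open>j\<close> rises by 1 and must
  not have been -1, since the factor in the relation is nonzero; entries of the same letter strictly
  between rise by 2.\<close>

lemma exchange_down:
  assumes u: "C u \<noteq> 0" and h: "h \<in> {1..N}" "u h = - 1"
  obtains j where "j \<in> {1..N}" "j < h" "\<iota> j = \<iota> h" "u j = 0"
    "C (\<lambda>p. u p + \<zeta> h p - \<zeta> j p) \<noteq> 0"
    "\<And>q. j < q \<Longrightarrow> q < h \<Longrightarrow> \<iota> q = \<iota> h \<Longrightarrow> u q = - 1"
proof -
  have "u \<noteq> (\<lambda>p. - \<zeta> h p)" using h(2) by (auto simp: \<zeta>_def fun_eq_iff intro!: exI[of _ h])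
  then obtain j where j: "j \<in> {1..N}" "j \<noteq> h" "\<iota> j = \<iota> h"
    "C (\<lambda>p. u p + \<zeta> h p - \<zeta> j p) \<noteq> 0" "u j + \<zeta> h j + 1 \<noteq> 0"
    using partner[OF u h(1)] h(2) by auto
  note b = bounds[OF j(4)]
  have "j < h"
  proof (rule ccontr)
    assume "\<not> j < h"
    then show False using b(2)[of h] j h by (simp add: \<zeta>_same)
  qed
  moreover have "u j = 0"
    using b(1)[of j] bounds(2)[OF u, of j] j h \<open>j < h\<close> by (simp add: \<zeta>_same)
  moreover have "u q = - 1" if "j < q" "q < h" "\<iota> q = \<iota> h" for q
  proof -
    have "q \<in> {1..N}" using that h by auto
    then show ?thesis
      using b(1)[of q] bounds(2)[OF u, of q] j h that by (simp add: \<zeta>_same)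
  qed
  ultimately show ?thesis using that j by blast
qed

text \<open>The mirror image: a partner in front of \<open>l\<close> would produce the entry 2 at
  \<open>l\<close>, and entries of the same letter strictly between \<open>l\<close> and
  \<open>h\<close> drop by 2.\<close>

lemma exchange_up:
  assumes u: "C u \<noteq> 0" and l: "l \<in> {1..N}" "u l = 1" and ne: "u \<noteq> (\<lambda>p. - \<zeta> l p)"
  obtains h where "h \<in> {1..N}" "l < h" "\<iota> h = \<iota> l" "u h = 0"
    "C (\<lambda>p. u p + \<zeta> l p - \<zeta> h p) \<noteq> 0"
    "\<And>q. l < q \<Longrightarrow> q < h \<Longrightarrow> \<iota> q = \<iota> l \<Longrightarrow> u q = 1"
proof -
  obtain h where h: "h \<in> {1..N}" "h \<noteq> l" "\<iota> h = \<iota> l"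
    "C (\<lambda>p. u p + \<zeta> l p - \<zeta> h p) \<noteq> 0" "u h + \<zeta> l h + 1 \<noteq> 0"
    using partner[OF u l(1) _ ne] l(2) by auto
  note b = bounds[OF h(4)]
  have "l < h"
  proof (rule ccontr)
    assume "\<not> l < h"
    then show False using b(1)[of l] l h by (simp add: \<zeta>_same)
  qed
  moreover have "u h = 0"
    using b(2)[of h] bounds(1)[OF u, of h] l h \<open>l < h\<close> by (simp add: \<zeta>_same)
  moreover have "u q = 1" if "l < q" "q < h" "\<iota> q = \<iota> l" for q
  proof -
    have "q \<in> {1..N}" using that h by auto
    then show ?thesis
      using b(2)[of q] bounds(1)[OF u, of q] l h that by (simp add: \<zeta>_same)
  qed
  ultimately show ?thesis using that h by blast
qed

section \<open>Firings\<close>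

definition nxt :: "nat \<Rightarrow> nat" where
  "nxt q = (LEAST p. q < p \<and> p \<le> N \<and> \<iota> p = \<iota> q)"

definition Q :: "nat set" where
  "Q = {q\<in>{1..N}. \<exists>p. q < p \<and> p \<le> N \<and> \<iota> p = \<iota> q}"

text \<open>The change of an exponent when \<open>q\<close> fires. By \<open>Y_eq\<close> it lives
  on the interval from \<open>q\<close> to \<open>nxt q\<close>, with entry 1 at both ends and
  entries 0 or -1 inside.\<close>

definition Y :: "nat \<Rightarrow> nat \<Rightarrow> int" where
  "Y q p = \<zeta> (nxt q) p - \<zeta> q p"

lemma finite_Q: "finite Q" by (simp add: Q_def)

lemma Q_range: "q \<in> Q \<Longrightarrow> q \<in> {1..N}" by (simp add: Q_def)

lemma nxt:
  assumes "q \<in> Q"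
  shows "q < nxt q" "nxt q \<in> {1..N}" "\<iota> (nxt q) = \<iota> q"
    "q < p \<Longrightarrow> p < nxt q \<Longrightarrow> \<iota> p \<noteq> \<iota> q"
proof -
  from assms obtain p0 where "q < p0 \<and> p0 \<le> N \<and> \<iota> p0 = \<iota> q" by (auto simp: Q_def)
  then have *: "q < nxt q \<and> nxt q \<le> N \<and> \<iota> (nxt q) = \<iota> q" unfolding nxt_def by (rule LeastI)
  then show "q < nxt q" "nxt q \<in> {1..N}" "\<iota> (nxt q) = \<iota> q" by auto
  show "\<iota> p \<noteq> \<iota> q" if "q < p" "p < nxt q"
    using not_less_Least[of p "\<lambda>p. q < p \<and> p \<le> N \<and> \<iota> p = \<iota> q"] that * unfolding nxt_def by auto
qed

lemma nxt_eqI: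
  assumes "q \<in> {1..N}" "q < h" "h \<le> N" "\<iota> h = \<iota> q" "\<And>p. q < p \<Longrightarrow> p < h \<Longrightarrow> \<iota> p \<noteq> \<iota> q"
  shows "q \<in> Q" "nxt q = h"
proof -
  show q: "q \<in> Q" using assms by (auto simp: Q_def)
  show "nxt q = h" using nxt[OF q] assms by (meson linorder_neqE_nat)
qed

lemma Y_eq:
  assumes "q \<in> Q"
  shows "Y q p = (if p = q \<or> p = nxt q then 1 else if q < p \<and> p < nxt q then c (\<iota> p) (\<iota> q) else 0)"
  using nxt(1-3)[OF assms] Q_range[OF assms] diag[of q]
  by (auto simp: Y_def \<zeta>_def)

lemma Y_between:
  assumes "q \<in> Q" "q < p" "p < nxt q"
  shows "c (\<iota> p) (\<iota> q) \<in> {0, - 1}"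
proof -
  have "p \<in> {1..N}" using assms nxt(2)[OF assms(1)] by auto
  then show ?thesis using off_diag[of p q] nxt(4)[OF assms] Q_range[OF assms(1)] by auto
qed

text \<open>The counts of firings determine the exponent, whatever their order.\<close>

definition U :: "(nat \<Rightarrow> int) \<Rightarrow> (nat \<Rightarrow> nat) \<Rightarrow> nat \<Rightarrow> int" where
  "U t m p = t p + (\<Sum>q\<in>Q. int (m q) * Y q p)"

lemma U_upd: "q \<in> Q \<Longrightarrow> U t (m(q := Suc (m q))) = (\<lambda>p. U t m p + Y q p)"
proof
  fix p assume q: "q \<in> Q"
  let ?m = "m(q := Suc (m q))"
  have "(\<Sum>r\<in>Q. int (?m r) * Y r p) = int (?m q) * Y q p + (\<Sum>r\<in>Q - {q}. int (?m r) * Y r p)"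
    using q finite_Q by (simp only: sum.remove)
  also have "(\<Sum>r\<in>Q - {q}. int (?m r) * Y r p) = (\<Sum>r\<in>Q - {q}. int (m r) * Y r p)"
    by (intro sum.cong) auto
  finally show "U t ?m p = U t m p + Y q p"
    using sum.remove[OF finite_Q q, of "\<lambda>r. int (m r) * Y r p"]
    by (simp add: U_def distrib_right)
qed

definition enabled :: "(nat \<Rightarrow> int) \<Rightarrow> nat \<Rightarrow> bool" where
  "enabled u q \<longleftrightarrow> q \<in> Q \<and> u q = 0 \<and> u (nxt q) = - 1"

lemma enabled_fire:
  assumes u: "C u \<noteq> 0" and e: "enabled u q"
  shows "C (\<lambda>p. u p + Y q p) \<noteq> 0"
proof -
  from e have q: "q \<in> Q" "u q = 0" "u (nxt q) = - 1" by (auto simp: enabled_def)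
  obtain j where j: "j \<in> {1..N}" "j < nxt q" "\<iota> j = \<iota> (nxt q)"
    "C (\<lambda>p. u p + \<zeta> (nxt q) p - \<zeta> j p) \<noteq> 0"
    "\<And>r. j < r \<Longrightarrow> r < nxt q \<Longrightarrow> \<iota> r = \<iota> (nxt q) \<Longrightarrow> u r = - 1"
    using exchange_down[OF u nxt(2)[OF q(1)] q(3)] by metis
  \<comment> \<open>An earlier \<open>j\<close> would force \<open>u q = -1\<close>, and no
    occurrence lies between \<open>q\<close> and \<open>nxt q\<close>.\<close>
  have "j = q"
  proof (rule ccontr)
    assume "j \<noteq> q"
    then consider "j < q" | "q < j" by linarith
    then show False using j nxt[OF q(1)] q(2) by cases (force, metis)
  qed
  then show ?thesis using j(4) by (simp add: Y_def algebra_simps)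
qed

text \<open>Firing \<open>q'\<close> could change the entry -1 at \<open>nxt q\<close> only
  downwards, against the bound. A change at \<open>q\<close> would need adjacent letters whose
  intervals are nested or interleaved; then one of the two firings would change the entry at the
  right end of the other interval.\<close>

lemma enabled_persist:
  assumes u: "C u \<noteq> 0" and e: "enabled u q" "enabled u q'" and ne: "q \<noteq> q'"
  shows "enabled (\<lambda>p. u p + Y q' p) q"
proof -
  have nz: "Y r' (nxt r) = 0" if e: "enabled u r" "enabled u r'" and "r \<noteq> r'" for r r'
  proof -
    have r: "r \<in> Q" "u r = 0" "u (nxt r) = - 1" and r': "r' \<in> Q" "u r' = 0" "u (nxt r') = - 1"
      using e by (auto simp: enabled_def)
    have "- 1 \<le> u (nxt r) + Y r' (nxt r)"
      using bounds(2)[OF enabled_fire[OF u e(2)]] .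
    moreover have "nxt r \<noteq> r'" using r r' by auto
    moreover have "nxt r \<noteq> nxt r'"
    proof
      assume n: "nxt r = nxt r'"
      then have "\<iota> r = \<iota> r'" using nxt(3) r(1) r'(1) by metis
      then show False using nxt(1,4)[OF r(1)] nxt(1,4)[OF r'(1)] n \<open>r \<noteq> r'\<close>
        by (metis linorder_neqE_nat)
    qed
    ultimately show ?thesis
      using Y_between[OF r'(1), of "nxt r"] r by (auto simp: Y_eq[OF r'(1)] split: if_splits)
  qed
  have q: "q \<in> Q" "u q = 0" "u (nxt q) = - 1" and q': "q' \<in> Q" "u q' = 0" "u (nxt q') = - 1"
    using e by (auto simp: enabled_def)
  have 1: "Y q' (nxt q) = 0" and 2: "Y q (nxt q') = 0" using nz e ne by auto
  have "Y q' q = 0"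
  proof (rule ccontr)
    assume "Y q' q \<noteq> 0"
    moreover have "q \<noteq> nxt q'" using q q' by auto
    ultimately have b: "q' < q" "q < nxt q'" "c (\<iota> q) (\<iota> q') \<noteq> 0"
      using ne by (auto simp: Y_eq[OF q'(1)] split: if_splits)
    have ii: "\<iota> q \<noteq> \<iota> q'" using nxt(4)[OF q'(1)] b by auto
    have s: "c (\<iota> q') (\<iota> q) \<noteq> 0"
      using off_diag[of q q'] ii b(3) Q_range q(1) q'(1) by auto
    show False
    proof (cases "nxt q < nxt q'")
      case True
      then show ?thesis using 1 b nxt[OF q(1)] ne by (auto simp: Y_eq[OF q'(1)] split: if_splits)
    next
      case False
      moreover have "nxt q \<noteq> nxt q'" using nxt(3)[OF q(1)] nxt(3)[OF q'(1)] ii by metis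
      ultimately show ?thesis using 2 b s nxt(3)[OF q'(1)] by (auto simp: Y_eq[OF q(1)] split: if_splits)
    qed
  qed
  then show ?thesis using 1 q by (simp add: enabled_def)
qed

section \<open>Firing sequences and their joins\<close>

inductive reach :: "(nat \<Rightarrow> int) \<Rightarrow> (nat \<Rightarrow> nat) \<Rightarrow> (nat \<Rightarrow> nat) \<Rightarrow> bool" for t where
  refl: "reach t m m"
| step: "enabled (U t m) q \<Longrightarrow> reach t (m(q := Suc (m q))) m' \<Longrightarrow> reach t m m'"

lemma reach_C: "reach t m m' \<Longrightarrow> C (U t m) \<noteq> 0 \<Longrightarrow> C (U t m') \<noteq> 0"
proof (induction rule: reach.induct)
  case (step m q m')
  then show ?case using enabled_fire[of "U t m" q] by (simp add: U_upd enabled_def del: fun_upd_apply)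
qed

lemma reach_le: "reach t m m' \<Longrightarrow> m r \<le> m' r"
proof (induction rule: reach.induct)
  case (step m q m')
  then show ?case by (cases "r = q") auto
qed simp

lemma reach_trans: "reach t m m' \<Longrightarrow> reach t m' m'' \<Longrightarrow> reach t m m''"
  by (induction rule: reach.induct) (auto intro: reach.step)

text \<open>An enabled position stays enabled until it fires. So along a sequence \<open>j\<close>
  either fires at some time and may be fired first, or it is still enabled at the end.\<close>

lemma strip:
  "reach t m m' \<Longrightarrow> C (U t m) \<noteq> 0 \<Longrightarrow> enabled (U t m) j \<Longrightarrow>
   (m j < m' j \<and> reach t (m(j := Suc (m j))) m') \<or>
   (m' j = m j \<and> enabled (U t m') j \<and> reach t (m(j := Suc (m j))) (m'(j := Suc (m' j))))"
proof (induction rule: reach.induct)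
  case (refl m)
  then show ?case by (auto intro: reach.refl)
next
  case (step m q m')
  let ?mq = "m(q := Suc (m q))" and ?mj = "m(j := Suc (m j))"
  show ?case
  proof (cases "q = j")
    case True
    then show ?thesis using step.hyps(2) reach_le[OF step.hyps(2), of j] by (simp add: Suc_le_eq del: fun_upd_apply) (simp add: Suc_le_eq)
  next
    case False
    have Qs: "q \<in> Q" "j \<in> Q" using step by (auto simp: enabled_def)
    have "C (U t ?mq) \<noteq> 0" using enabled_fire[OF step.prems(1) step.hyps(1)] Qs by (simp add: U_upd)
    moreover have "enabled (U t ?mq) j"
      using enabled_persist[OF step.prems(1,2) step.hyps(1)] False Qs by (simp add: U_upd)
    ultimately have IH: "(?mq j < m' j \<and> reach t (?mq(j := Suc (?mq j))) m') \<or>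
      (m' j = ?mq j \<and> enabled (U t m') j \<and> reach t (?mq(j := Suc (?mq j))) (m'(j := Suc (m' j))))"
      by (rule step.IH)
    have "enabled (U t ?mj) q"
      using enabled_persist[OF step.prems(1) step.hyps(1) step.prems(2)] False Qs by (simp add: U_upd)
    moreover have "?mj(q := Suc (?mj q)) = ?mq(j := Suc (?mq j))" using False by auto
    ultimately have "reach t ?mj (?mq(j := Suc (?mq j)))"
      using reach.step[of t ?mj q] reach.refl by metis
    then have R: "reach t ?mj x" if "reach t (?mq(j := Suc (?mq j))) x" for x
      using that by (rule reach_trans)
    have "?mq j = m j" using False by simp
    then show ?thesis using IH R[of m'] R[of "m'(j := Suc (m' j))"] by argo
  qed
qed

text \<open>The abelian property known from chip firing. Let \<open>j\<close> be the first firing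
  towards \<open>m1\<close>. By \<open>strip\<close> the sequence towards \<open>m2\<close> can also
  start with \<open>j\<close>, if necessary after appending \<open>j\<close> to it; then
  induct.\<close>

lemma reach_max:
  "reach t m m1 \<Longrightarrow> C (U t m) \<noteq> 0 \<Longrightarrow> reach t m m2 \<Longrightarrow> reach t m2 (\<lambda>q. max (m1 q) (m2 q))"
proof (induction arbitrary: m2 rule: reach.induct)
  case (refl m)
  then have "(\<lambda>q. max (m q) (m2 q)) = m2" using reach_le by (auto simp: max_def fun_eq_iff)
  then show ?case by (simp add: reach.refl)
next
  case (step m j m1)
  let ?mj = "m(j := Suc (m j))"
  have j: "j \<in> Q" using step by (simp add: enabled_def)
  have Cj: "C (U t ?mj) \<noteq> 0" using enabled_fire[OF step.prems(1) step.hyps(1)] j by (simp add: U_upd)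
  consider "reach t ?mj m2"
    | "m2 j = m j" "enabled (U t m2) j" "reach t ?mj (m2(j := Suc (m2 j)))"
    using strip[OF step.prems(2,1) step.hyps(1)] by blast
  then show ?case
  proof cases
    case 1
    then show ?thesis by (rule step.IH[OF Cj])
  next
    case 2
    \<comment> \<open>\<open>m1\<close> already counts this firing of \<open>j\<close> while
      \<open>m2 j = m j\<close>, so firing \<open>j\<close> after \<open>m2\<close> does not alter
      the maximum.\<close>
    have "m j < m1 j" using reach_le[OF step.hyps(2), of j] by simp
    then have "(\<lambda>q. max (m1 q) ((m2(j := Suc (m2 j))) q)) = (\<lambda>q. max (m1 q) (m2 q))"
      using 2(1) by (auto simp: fun_eq_iff)
    then show ?thesis using step.IH[OF Cj 2(3)] 2(2) reach.step by metis
  qed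
qed


section \<open>Every exponent is reached from the start of its degree\<close>

definition lex_less :: "(nat \<Rightarrow> int) \<Rightarrow> (nat \<Rightarrow> int) \<Rightarrow> bool" where
  "lex_less u v \<longleftrightarrow> (\<exists>k. (\<forall>p<k. u p = v p) \<and> u k < v k)"

lemma lex_less_trans: "lex_less u v \<Longrightarrow> lex_less v w \<Longrightarrow> lex_less u w"
proof -
  assume "lex_less u v" "lex_less v w"
  then obtain k l where k: "\<forall>p<k. u p = v p" "u k < v k" and l: "\<forall>p<l. v p = w p" "v l < w l"
    by (auto simp: lex_less_def)
  have "\<forall>p<min k l. u p = w p" using k l by simp
  moreover have "u (min k l) < w (min k l)"
    using k l by (cases k l rule: linorder_cases) (auto simp: min_def)
  ultimately show ?thesis unfolding lex_less_def by blast
qed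

text \<open>Only finitely many exponents occur, so the lexicographic order on them is
  well-founded.\<close>

lemma lex_induct [consumes 1, case_names less]:
  assumes "C u \<noteq> 0"
    and "\<And>u. C u \<noteq> 0 \<Longrightarrow> (\<And>v. C v \<noteq> 0 \<Longrightarrow> lex_less v u \<Longrightarrow> P v) \<Longrightarrow> P u"
  shows "P u"
  using assms(1)
proof (induction "card {v. C v \<noteq> 0 \<and> lex_less v u}" arbitrary: u rule: less_induct)
  case less
  have "P v" if v: "C v \<noteq> 0" "lex_less v u" for v
  proof (rule less.hyps[OF _ v(1)], rule psubset_card_mono)
    show "finite {v. C v \<noteq> 0 \<and> lex_less v u}" using finite_support by (rule rev_finite_subset) auto
    have "\<not> lex_less v v" by (auto simp: lex_less_def)
    then show "{w. C w \<noteq> 0 \<and> lex_less w v} \<subset> {v. C v \<noteq> 0 \<and> lex_less v u}"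
      using v lex_less_trans by blast
  qed
  then show ?case using assms(2)[OF less.prems] by blast
qed

definition last_pos :: "nat \<Rightarrow> nat" where
  "last_pos a = Max {l\<in>{1..N}. \<iota> l = a}"

definition start :: "nat \<Rightarrow> (nat \<Rightarrow> int)" where
  "start a = (\<lambda>p. - \<zeta> (last_pos a) p)"

lemma U_0: "U t (\<lambda>_. 0) = t" by (simp add: U_def fun_eq_iff)

text \<open>Firings are undone at the last entry 1: there \<open>exchange_up\<close> yields a
  lexicographically smaller exponent of the same degree, unless \<open>u\<close> is already the
  negative of \<open>\<zeta> l\<close>.\<close>

lemma reach_start:
  assumes "C u \<noteq> 0"
  obtains m where "C (start (dg u)) \<noteq> 0" "reach (start (dg u)) (\<lambda>_. 0) m" "U (start (dg u)) m = u"
proof -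
  have "\<exists>m. C (start (dg u)) \<noteq> 0 \<and> reach (start (dg u)) (\<lambda>_. 0) m \<and> U (start (dg u)) m = u"
    using assms
  proof (induction rule: lex_induct)
    case (less u)
    let ?M = "{l\<in>{1..N}. u l = 1}"
    define l where "l = Max ?M"
    have "?M \<noteq> {}" using has_pos[OF less.hyps] outside[OF less.hyps] by fastforce
    then have "l \<in> ?M" unfolding l_def by (intro Max_in) auto
    then have l: "l \<in> {1..N}" "u l = 1" by auto
    have lmax: "u q \<noteq> 1" if "l < q" "q \<in> {1..N}" for q
      using that Max_ge[of ?M q] unfolding l_def[symmetric] by fastforce
    show ?case
    proof (cases "u = (\<lambda>p. - \<zeta> l p)")
      case True
      have dg: "dg u = \<iota> l" using dg_top[OF l(1)] less.hyps True by simp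
      \<comment> \<open>A later occurrence of the letter would carry the entry 2, so
        \<open>l\<close> is the last one.\<close>
      have "Max {q\<in>{1..N}. \<iota> q = \<iota> l} = l"
      proof (rule Max_eqI)
        fix q assume q: "q \<in> {q\<in>{1..N}. \<iota> q = \<iota> l}"
        show "q \<le> l"
        proof (rule ccontr)
          assume "\<not> q \<le> l"
          then have "u q = 2" using True q l(1) by (simp add: \<zeta>_same)
          then show False using bounds(1)[OF less.hyps, of q] by simp
        qed
      qed (use l in auto)
      then have "start (dg u) = u" unfolding dg start_def last_pos_def using True by simp
      then show ?thesis using less.hyps reach.refl U_0 by metis
    next
      case False
      obtain h where h: "h \<in> {1..N}" "l < h" "\<iota> h = \<iota> l" "u h = 0"
        "C (\<lambda>p. u p + \<zeta> l p - \<zeta> h p) \<noteq> 0"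
        "\<And>q. l < q \<Longrightarrow> q < h \<Longrightarrow> \<iota> q = \<iota> l \<Longrightarrow> u q = 1"
        using exchange_up[OF less.hyps l False] by metis
      \<comment> \<open>An occurrence in between would carry 1, but \<open>l\<close> is the last
        position with that entry; so \<open>h\<close> is the next occurrence.\<close>
      have "\<iota> q \<noteq> \<iota> l" if "l < q" "q < h" for q using h(6)[OF that] lmax[OF that(1)] that h(1) by auto
      then have lQ: "l \<in> Q" and n: "nxt l = h" using nxt_eqI[of l h] l h by auto
      define v where "v = (\<lambda>p. u p + \<zeta> l p - \<zeta> h p)"
      have v: "v p = u p - Y l p" for p by (simp add: v_def Y_def n)
      have Cv: "C v \<noteq> 0" using h(5) by (simp add: v_def)
      have dgv: "dg v = dg u" unfolding v_def using dg_shift l h less.hyps by simp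
      have "lex_less v u"
        unfolding lex_less_def by (rule exI[of _ l]) (use nxt[OF lQ] in \<open>auto simp: v Y_eq[OF lQ]\<close>)
      from less.IH[OF Cv this] obtain m where m: "C (start (dg u)) \<noteq> 0"
        "reach (start (dg u)) (\<lambda>_. 0) m" "U (start (dg u)) m = v" unfolding dgv by blast
      have "enabled v l" using lQ l h n by (simp add: enabled_def v Y_eq[OF lQ])
      then have "reach (start (dg u)) (\<lambda>_. 0) (m(l := Suc (m l)))"
        using m(2,3) reach.step reach.refl reach_trans by metis
      moreover have "U (start (dg u)) (m(l := Suc (m l))) = u" by (simp add: U_upd[OF lQ] m(3) v)
      ultimately show ?thesis using m(1) by blast
    qed
  qed
  then show ?thesis using that by blast
qed

section \<open>Opposite entries at the first difference\<close>

lemma Y_triangular: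
  assumes "\<And>p. p < k \<Longrightarrow> (\<Sum>q\<in>Q. \<delta> q * Y q p) = 0" "q \<in> Q" "q < k"
  shows "\<delta> q = 0"
  using assms(2,3)
proof (induction q rule: less_induct)
  case (less q)
  \<comment> \<open>\<open>Y r\<close> vanishes before \<open>r\<close> and has entry 1 at
    \<open>r\<close>, so the linear system is triangular.\<close>
  have "(\<Sum>r\<in>Q. \<delta> r * Y r q) = \<delta> q * Y q q + (\<Sum>r\<in>Q - {q}. \<delta> r * Y r q)"
    using less.prems finite_Q by (simp add: sum.remove)
  also have "(\<Sum>r\<in>Q - {q}. \<delta> r * Y r q) = 0"
  proof (intro sum.neutral ballI)
    fix r assume r: "r \<in> Q - {q}"
    show "\<delta> r * Y r q = 0"
    proof (cases "r < q")
      case True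
      then show ?thesis using less r by simp
    next
      case False
      then show ?thesis using r nxt(1)[of r] by (simp add: Y_eq)
    qed
  qed
  finally show ?case using assms(1)[OF less.prems(2)] less.prems(1) by (simp add: Y_eq)
qed

lemma \<zeta>_telescope:
  assumes "j \<in> {1..N}" "h \<in> {1..N}" "j \<le> h" "\<iota> j = \<iota> h"
  shows "(\<Sum>q\<in>{q\<in>Q. j \<le> q \<and> q < h \<and> \<iota> q = \<iota> h}. Y q p) = \<zeta> h p - \<zeta> j p"
  using assms
proof (induction "h - j" arbitrary: j rule: less_induct)
  case less
  show ?case
  proof (cases "j = h")
    case True
    then show ?thesis by (auto intro: sum.neutral)
  next
    case False
    let ?A = "\<lambda>j. {q\<in>Q. j \<le> q \<and> q < h \<and> \<iota> q = \<iota> h}"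
    have "j < h" using less.prems(3) False by simp
    then have jQ: "j \<in> Q" using less.prems by (auto simp: Q_def)
    note n = nxt[OF jQ]
    have nh: "nxt j \<le> h" using n(4)[of h] less.prems False by (cases "h < nxt j") auto
    have "?A j = insert j (?A (nxt j))"
    proof (intro equalityI subsetI)
      fix q assume "q \<in> ?A j"
      then show "q \<in> insert j (?A (nxt j))" using n(4)[of q] less.prems by (cases "q < nxt j") (auto simp: less_le)
    qed (use n(1) jQ less.prems False in auto)
    moreover have "j \<notin> ?A (nxt j)" using n(1) by auto
    ultimately have "sum (\<lambda>q. Y q p) (?A j) = Y j p + sum (\<lambda>q. Y q p) (?A (nxt j))"
      using finite_Q by simp
    also have "sum (\<lambda>q. Y q p) (?A (nxt j)) = \<zeta> h p - \<zeta> (nxt j) p"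
      using less.hyps[of "nxt j"] n less.prems nh by auto
    finally show ?thesis by (simp add: Y_def)
  qed
qed

text \<open>Exchange the entry -1 of \<open>u'\<close> at \<open>k\<close> against an earlier
  occurrence to get \<open>v\<close>, and join the firing counts of \<open>u\<close> and
  \<open>v\<close>. Before \<open>k\<close> the join exceeds the counts of \<open>u\<close> exactly
  by the exchange, and at \<open>k\<close> it equals them. So the joined exponent has entry 2 at
  \<open>k\<close>, against the bound.\<close>

theorem no_opposite:
  assumes u: "C u \<noteq> 0" and u': "C u' \<noteq> 0" and dg: "dg u = dg u'"
    and prefix: "\<And>p. p < k \<Longrightarrow> u p = u' p" and k: "u k = 1" "u' k = - 1"
  shows False
proof -
  let ?t = "start (dg u)"
  have kN: "k \<in> {1..N}" using outside[OF u, of k] k by auto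
  obtain j where j: "j \<in> {1..N}" "j < k" "\<iota> j = \<iota> k" "u' j = 0"
    "C (\<lambda>p. u' p + \<zeta> k p - \<zeta> j p) \<noteq> 0"
    using exchange_down[OF u' kN k(2)] by metis
  define v where "v = (\<lambda>p. u' p + \<zeta> k p - \<zeta> j p)"
  have Cv: "C v \<noteq> 0" using j(5) by (simp add: v_def)
  have dgv: "dg v = dg u" using dg_shift[OF kN j(1)] j u' dg by (simp add: v_def)
  obtain m where m: "C ?t \<noteq> 0" "reach ?t (\<lambda>_. 0) m" "U ?t m = u"
    using reach_start[OF u] by blast
  obtain m' where m': "reach ?t (\<lambda>_. 0) m'" "U ?t m' = v"
    using reach_start[OF Cv] unfolding dgv by blast
  let ?M = "\<lambda>q. max (m q) (m' q)"
  let ?A = "{q\<in>Q. j \<le> q \<and> q < k \<and> \<iota> q = \<iota> k}"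
  \<comment> \<open>The exchange from \<open>u'\<close> to \<open>v\<close> as firings: one at each
    occurrence from \<open>j\<close> up to the last one before \<open>k\<close>.\<close>
  let ?chi = "\<lambda>q. if q \<in> ?A then 1 else 0 :: int"
  have "reach ?t m' ?M" using reach_max[OF m(2) _ m'(1)] m(1) by (simp add: U_0)
  then have CM: "C (U ?t ?M) \<noteq> 0" using reach_C m'(2) Cv by metis
  have chi: "(\<Sum>q\<in>Q. ?chi q * Y q p) = \<zeta> k p - \<zeta> j p" for p
  proof -
    have "(\<Sum>q\<in>Q. ?chi q * Y q p) = (\<Sum>q\<in>Q. if q \<in> ?A then Y q p else 0)"
      by (intro sum.cong) auto
    also have "\<dots> = (\<Sum>q\<in>?A. Y q p)" using finite_Q
      by (simp add: sum.inter_filter[symmetric])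
    finally show ?thesis using \<zeta>_telescope[OF j(1) kN _ j(3)] j(2) by simp
  qed
  have up: "(\<Sum>q\<in>Q. int (m q) * Y q p) = u p - ?t p" for p using fun_cong[OF m(3), of p] by (simp add: U_def)
  have vp: "(\<Sum>q\<in>Q. int (m' q) * Y q p) = v p - ?t p" for p using fun_cong[OF m'(2), of p] by (simp add: U_def)
  \<comment> \<open>Formal counts leading from \<open>u\<close> to \<open>u'\<close>, possibly
    negative; triangularity makes them vanish before \<open>k\<close>.\<close>
  let ?d = "\<lambda>q. int (m' q) - int (m q) - ?chi q"
  have d: "(\<Sum>q\<in>Q. ?d q * Y q p) = u' p - u p" for p
  proof -
    have "(\<Sum>q\<in>Q. ?d q * Y q p) = (\<Sum>q\<in>Q. int (m' q) * Y q p) - (\<Sum>q\<in>Q. int (m q) * Y q p)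
        - (\<Sum>q\<in>Q. ?chi q * Y q p)"
      by (simp only: left_diff_distrib sum_subtractf)
    also have "\<dots> = v p - u p - (\<zeta> k p - \<zeta> j p)"
      unfolding chi up vp by simp
    finally show ?thesis by (simp add: v_def)
  qed
  have d0: "?d q = 0" if "q \<in> Q" "q < k" for q
    by (rule Y_triangular[of k ?d]) (use d prefix that in auto)
  have Yk: "Y q k = 0" if "q \<in> Q" "k < q" for q using that nxt(1)[of q] by (simp add: Y_eq)
  have "(\<Sum>q\<in>Q. ?d q * Y q k) = (\<Sum>q\<in>Q. if q = k then ?d q * Y q k else 0)"
  proof (rule sum.cong[OF HOL.refl])
    fix q assume q: "q \<in> Q"
    consider "q < k" | "q = k" | "k < q" by linarith
    then show "?d q * Y q k = (if q = k then ?d q * Y q k else 0)"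
      using d0[OF q] Yk[OF q] by cases simp_all
  qed
  also have "\<dots> = (if k \<in> Q then ?d k * Y k k else 0)" using finite_Q by simp
  \<comment> \<open>The entries at \<open>k\<close> differ by -2, so \<open>u\<close> has fired
    \<open>k\<close> twice more than \<open>v\<close>, and the join agrees with \<open>u\<close>
    there.\<close>
  finally have "k \<in> Q" "?d k = - 2" using d[of k] k by (auto simp: Y_eq split: if_splits)
  then have Mk: "?M k = m k" by auto
  have "U ?t ?M k - u k = (\<Sum>q\<in>Q. (int (?M q) - int (m q)) * Y q k)"
    unfolding left_diff_distrib sum_subtractf up by (simp add: U_def)
  also have "\<dots> = (\<Sum>q\<in>Q. ?chi q * Y q k)"
  proof (rule sum.cong[OF HOL.refl])
    fix q assume q: "q \<in> Q"
    consider "q < k" | "q = k" | "k < q" by linarith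
    then show "(int (?M q) - int (m q)) * Y q k = ?chi q * Y q k"
    proof cases
      case 1
      then have "int (m' q) = int (m q) + ?chi q" using d0[OF q] by simp
      then have "int (?M q) - int (m q) = ?chi q" by (auto split: if_splits)
      then show ?thesis by simp
    qed (use Mk Yk q in auto)
  qed
  also have "\<dots> = 1" unfolding chi using j kN by (simp add: \<zeta>_same)
  finally show False using bounds(1)[OF CM, of k] k by simp
qed

end

section \<open>The exponents of the potential\<close>

lemma rf_subst_var: "rf_subst \<Phi> (rf_var k) = \<Phi> k"
proof -
  have 1: "poly_subst \<Phi> 1 = 1"
    using poly_subst_single[of \<Phi> 0 1] by (simp add: rf_const_1)
  have "poly_subst \<Phi> (Poly_Mapping.single (Poly_Mapping.single k 1) 1) = \<Phi> k"
    by (simp add: poly_subst_single rf_const_1)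
  then show ?thesis unfolding rf_var_def by (subst rf_subst_Fract) (simp_all add: 1)
qed

locale longest_word = simply_laced_matrix +
  fixes w0 :: "(nat \<Rightarrow> int) \<Rightarrow> (nat \<Rightarrow> int)" and \<sigma> :: "nat list \<Rightarrow> nat \<Rightarrow> ratfun"
    and i :: "nat list" and F :: laurent
  assumes longest: "longest_element n c w0"
    and word: "i \<in> reduced_words n c w0"
    and family: "varsigma_family n c w0 \<sigma>"
    and laurent: "laurent_to_rf F = (\<Sum>a=1..n. \<sigma> i a)"
    and exponents: "\<And>u k. u \<in> Poly_Mapping.keys F \<Longrightarrow> k \<in> {1..length i} \<Longrightarrow> \<bar>Poly_Mapping.lookup u k\<bar> \<le> 1"
begin

abbreviation "N \<equiv> length i"
abbreviation "L \<equiv> Poly_Mapping.lookup"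
abbreviation "keys \<equiv> Poly_Mapping.keys"

definition \<iota> :: "nat \<Rightarrow> nat" where
  "\<iota> l = i ! (l - 1)"

definition \<beta> :: "nat \<Rightarrow> nat \<Rightarrow> int" where
  "\<beta> l = root (drop l i) (\<iota> l)"

definition \<zeta> :: "nat \<Rightarrow> nat \<Rightarrow> int" where
  "\<zeta> l p = (if p = l then - 1 else if l < p \<and> p \<le> N then - c (\<iota> p) (\<iota> l) else 0)"

definition zt :: "nat \<Rightarrow> nat \<Rightarrow>\<^sub>0 int" where
  "zt l = Abs_poly_mapping (\<zeta> l)"

definition \<Theta> :: "nat \<Rightarrow> ratfun \<Rightarrow> ratfun" where
  "\<Theta> b f = (\<Sum>l\<in>{l\<in>{1..N}. \<iota> l = b}. lmon (zt l) * euler l f)"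

definition \<Delta> :: "nat \<Rightarrow> ratfun \<Rightarrow> ratfun" where
  "\<Delta> b f = (\<Sum>l\<in>{1..N}. of_int (\<beta> l b) * euler l f)"

text \<open>\<open>ratfun\<close> has a variable for every natural number; these derivations detect
  the ones outside the chart.\<close>

definition outer :: "(ratfun \<Rightarrow> ratfun) set" where
  "outer = {euler l | l. l \<notin> {1..N}}"

lemma letters_i: "letters i" and reduced_i: "reduced i"
  using word by (auto simp: reduced_words_iff reduced_def)

lemma \<iota>_range: "l \<in> {1..N} \<Longrightarrow> \<iota> l \<in> {1..n}"
proof -
  assume "l \<in> {1..N}"
  then have "\<iota> l \<in> set i" by (auto simp: \<iota>_def)
  then show ?thesis using letters_i unfolding letters_def by blast
qed

lemma drop_i: "l \<in> {1..N} \<Longrightarrow> drop (l - 1) i = \<iota> l # drop l i"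
  using Cons_nth_drop_Suc[of "l - 1" i] by (auto simp: \<iota>_def)

lemma letters_drop: "letters (drop l i)"
  using letters_i set_drop_subset[of l i] by (auto simp: letters_def)

lemma \<beta>_nonneg: "l \<in> {1..N} \<Longrightarrow> 0 \<le> \<beta> l b"
proof -
  assume "l \<in> {1..N}"
  then have "reduced (take (l - 1) i @ \<iota> l # drop l i)"
    using reduced_i drop_i append_take_drop_id by metis
  then show ?thesis unfolding \<beta>_def by (rule root_nonneg)
qed

lemma lookup_zt: "L (zt l) = \<zeta> l"
proof -
  have "{p. \<zeta> l p \<noteq> 0} \<subseteq> insert l {..N}" by (auto simp: \<zeta>_def)
  then have "finite {p. \<zeta> l p \<noteq> 0}" by (rule finite_subset) simp
  then show ?thesis by (simp add: zt_def)
qed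

lemma reindex_tail:
  assumes "l \<in> {1..N}"
  shows "bij_betw (\<lambda>q. Suc q + l) {..<length (drop l i)} {l<..N}"
  by (rule bij_betw_byWitness[where f' = "\<lambda>p. p - Suc l"]) auto

definition degree :: "(nat \<Rightarrow> int) \<Rightarrow> nat \<Rightarrow> int" where
  "degree u b = (\<Sum>l\<in>{1..N}. \<beta> l b * u l)"

text \<open>By \<open>root_sum\<close>, \<open>\<beta> l\<close> plus a weighted sum of the later
  roots is a simple root, and \<open>\<zeta> l\<close> carries the negatives of these
  weights.\<close>

lemma degree_\<zeta>: "l \<in> {1..N} \<Longrightarrow> degree (\<zeta> l) b = - \<alpha> (\<iota> l) b"
proof -
  assume l: "l \<in> {1..N}"
  let ?d = "drop l i"
  have "(\<Sum>q<length ?d. c (?d ! q) (\<iota> l) * root (drop (Suc q) ?d) (?d ! q) b) =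
      (\<Sum>q<length ?d. c (\<iota> (Suc q + l)) (\<iota> l) * \<beta> (Suc q + l) b)"
    by (rule sum.cong) (simp_all add: \<beta>_def \<iota>_def ac_simps)
  also have "\<dots> = (\<Sum>p\<in>{l<..N}. c (\<iota> p) (\<iota> l) * \<beta> p b)"
    by (rule sum.reindex_bij_betw[OF reindex_tail[OF l]])
  finally have \<beta>: "\<beta> l b = \<alpha> (\<iota> l) b - (\<Sum>p\<in>{l<..N}. c (\<iota> p) (\<iota> l) * \<beta> p b)"
    using root_sum[OF letters_drop \<iota>_range[OF l], of l b] by (simp add: \<beta>_def)
  have "degree (\<zeta> l) b = (\<Sum>p\<in>insert l {l<..N}. \<beta> p b * \<zeta> l p)"
    unfolding degree_def using l by (intro sum.mono_neutral_right) (auto simp: \<zeta>_def)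
  also have "\<dots> = - \<beta> l b - (\<Sum>p\<in>{l<..N}. c (\<iota> p) (\<iota> l) * \<beta> p b)"
    by (simp add: \<zeta>_def sum_negf[symmetric] mult.commute)
  finally show ?thesis using \<beta> by simp
qed

lemma derivation_\<Theta>: "derivation (\<Theta> b)" and derivation_\<Delta>: "derivation (\<Delta> b)"
  unfolding \<Theta>_def \<Delta>_def by (intro derivation_combination derivation_euler)+

sublocale flow n c \<Theta> \<Delta> outer
  using derivation_\<Theta> derivation_\<Delta> derivation_euler by unfold_locales (auto simp: outer_def)

lemma \<Theta>_var: "l \<in> {1..N} \<Longrightarrow> \<Theta> b (rf_var l) = (if \<iota> l = b then lmon (zt l) * rf_var l else 0)"
proof -
  assume l: "l \<in> {1..N}"
  have "\<Theta> b (rf_var l) = (\<Sum>q\<in>{q\<in>{1..N}. \<iota> q = b}. if q = l then lmon (zt l) * rf_var l else 0)"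
    unfolding \<Theta>_def by (intro sum.cong) (auto simp: euler_var)
  then show ?thesis using l by (simp add: sum.delta)
qed

lemma \<Delta>_var: "l \<in> {1..N} \<Longrightarrow> \<Delta> b (rf_var l) = of_int (\<beta> l b) * rf_var l"
proof -
  assume l: "l \<in> {1..N}"
  have "\<Delta> b (rf_var l) = (\<Sum>q\<in>{1..N}. if q = l then of_int (\<beta> l b) * rf_var l else 0)"
    unfolding \<Delta>_def by (intro sum.cong) (auto simp: euler_var)
  then show ?thesis using l by (simp add: sum.delta)
qed

lemma lmon_zt:
  assumes l: "l \<in> {1..N}"
  shows "lmon (zt l) * rf_var l = (\<Prod>p\<in>{l<..N}. rf_var p powi (- c (\<iota> p) (\<iota> l)))"
proof -
  have "keys (zt l) \<subseteq> insert l {l<..N}" by (auto simp: in_keys_iff lookup_zt \<zeta>_def split: if_splits)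
  then have "lmon (zt l) = (\<Prod>p\<in>insert l {l<..N}. rf_var p powi L (zt l) p)"
    by (intro lmon_superset) auto
  also have "\<dots> = rf_var l powi (- 1) * (\<Prod>p\<in>{l<..N}. rf_var p powi (- c (\<iota> p) (\<iota> l)))"
    by (simp add: lookup_zt \<zeta>_def)
  finally show ?thesis using rf_var_nonzero[of l] by (simp add: power_int_minus)
qed

text \<open>The suffixes of \<open>i\<close> are built up from the right; the shift by
  \<open>k\<close> keeps the original numbering of the variables. The tail product behind position
  \<open>l\<close> is the factor by which \<open>\<Theta>\<close> was defined, multiplied by the
  variable.\<close>

lemma compatible_start: "compatible (pairs i rf_var)"
proof -
  have "k \<le> N \<Longrightarrow> compatible (pairs (drop k i) (\<lambda>q. rf_var (q + k)))" for k
  proof (induction "N - k" arbitrary: k)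
    case 0
    then show ?case by (simp add: pairs_def)
  next
    case (Suc m)
    let ?l = "Suc k" and ?w = "drop (Suc k) i"
    have l: "?l \<in> {1..N}" using Suc by auto
    let ?zs = "pairs ?w (\<lambda>q. rf_var (q + ?l))"
    have zs: "pairs (drop k i) (\<lambda>q. rf_var (q + k)) = (\<iota> ?l, rf_var ?l) # ?zs"
      using drop_i[OF l] by (simp add: pairs_Cons)
    have "tail_prod (\<iota> ?l) ?zs = (\<Prod>q<length ?w. rf_var (Suc q + ?l) powi (- c (\<iota> (Suc q + ?l)) (\<iota> ?l)))"
      unfolding tail_prod_pairs by (rule prod.cong) (simp_all add: \<iota>_def ac_simps)
    also have "\<dots> = (\<Prod>p\<in>{?l<..N}. rf_var p powi (- c (\<iota> p) (\<iota> ?l)))"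
      by (rule prod.reindex_bij_betw[OF reindex_tail[OF l]])
    finally have tp: "tail_prod (\<iota> ?l) ?zs = lmon (zt ?l) * rf_var ?l" using lmon_zt[OF l] by simp
    have "compatible ?zs" using Suc.hyps(1)[of ?l] Suc.hyps(2) l by simp
    moreover have "E (rf_var ?l) = 0" if "E \<in> outer" for E
      using that l by (auto simp: euler_var outer_def)
    ultimately show ?case unfolding zs using tp
      by (auto simp: rf_pos_var \<Theta>_var[OF l] \<Delta>_var[OF l] \<beta>_def)
  qed
  from this[of 0] show ?thesis by simp
qed

text \<open>In the chart of a word ending with \<open>a\<close> the function is the last coordinate.
  Nothing stands behind it, so its tail product is 1 and its root is
  \<open>\<alpha> a\<close>.\<close>

lemma \<sigma>_equations:
  assumes a: "a \<in> {1..n}"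
  shows "b \<in> {1..n} \<Longrightarrow> \<Theta> b (\<sigma> i a) = (if a = b then 1 else 0)"
    and "b \<in> {1..n} \<Longrightarrow> \<Delta> b (\<sigma> i a) = (if a = b then \<sigma> i a else 0)"
    and "l \<notin> {1..N} \<Longrightarrow> euler l (\<sigma> i a) = 0"
proof -
  obtain v where v: "moves i (v @ [a])" "v @ [a] \<in> reduced_words n c w0"
    using longest_moves_to_last[OF longest word a] by blast
  obtain \<Phi> where \<Phi>: "transition c i (v @ [a]) \<Phi>" using moves_transition[OF v(1)] by blast
  have "\<sigma> (v @ [a]) a = rf_var (length (v @ [a]))"
    using family v(2) a unfolding varsigma_family_def by force
  moreover have "rf_subst \<Phi> (\<sigma> (v @ [a]) a) = \<sigma> i a"
    using family v(2) a word \<Phi> unfolding varsigma_family_def by blast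
  ultimately have \<sigma>: "\<sigma> i a = \<Phi> (Suc (length v))" by (simp add: rf_subst_var)
  have "compatible (pairs (v @ [a]) \<Phi>)"
    using transition_compatible[OF \<Phi> letters_i compatible_start] by blast
  moreover have "pairs (v @ [a]) \<Phi> = pairs v \<Phi> @ [(a, \<sigma> i a)]"
    by (simp add: \<sigma> pairs_append pairs_Cons pairs_def[of "[]"])
  ultimately have C: "compatible [(a, \<sigma> i a)]" using compatible_appendD by metis
  then show "b \<in> {1..n} \<Longrightarrow> \<Theta> b (\<sigma> i a) = (if a = b then 1 else 0)"
    and "b \<in> {1..n} \<Longrightarrow> \<Delta> b (\<sigma> i a) = (if a = b then \<sigma> i a else 0)"
    by (auto simp: root_def \<alpha>_def)
  show "l \<notin> {1..N} \<Longrightarrow> euler l (\<sigma> i a) = 0" using C unfolding compatible.simps(2) by (metis (mono_tags, lifting) mem_Collect_eq outer_def)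
qed

section \<open>Comparison of coefficients\<close>

abbreviation "f \<equiv> laurent_to_rf F"

lemma \<Theta>_f: "b \<in> {1..n} \<Longrightarrow> \<Theta> b f = 1"
  unfolding laurent derivation_sum[OF derivation_\<Theta>] by (simp add: \<sigma>_equations(1))

lemma \<Delta>_f: "b \<in> {1..n} \<Longrightarrow> \<Delta> b f = \<sigma> i b"
proof -
  assume b: "b \<in> {1..n}"
  have "\<Delta> b f = (\<Sum>a=1..n. if a = b then \<sigma> i b else 0)"
    unfolding laurent derivation_sum[OF derivation_\<Delta>] using b by (intro sum.cong) (auto simp: \<sigma>_equations(2))
  then show ?thesis using b by simp
qed

text \<open>Euler and degree derivations act diagonally on Laurent monomials, so identities between
  derivatives of \<open>f\<close> become identities between integer weights of the
  exponents.\<close>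

definition weighted :: "((nat \<Rightarrow>\<^sub>0 int) \<Rightarrow> int) \<Rightarrow> ratfun" where
  "weighted h = (\<Sum>u\<in>keys F. rf_const (L F u * of_int (h u)) * lmon u)"

lemma weighted_inject: "weighted h = weighted h' \<Longrightarrow> u \<in> keys F \<Longrightarrow> h u = h' u"
proof -
  assume "weighted h = weighted h'" and u: "u \<in> keys F"
  then have "(\<Sum>u\<in>keys F. rf_const (L F u * of_int (h u) - L F u * of_int (h' u)) * lmon u) = 0"
    by (simp add: weighted_def rf_const_diff left_diff_distrib sum_subtractf)
  from lmon_independent[OF _ this u] show ?thesis using u by (simp add: in_keys_iff)
qed

lemma f_weighted: "f = weighted (\<lambda>_. 1)"
  by (simp add: weighted_def laurent_to_rf_eq)

lemma euler_weighted: "euler l (weighted h) = weighted (\<lambda>u. h u * L u l)"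
  unfolding weighted_def derivation_sum[OF derivation_euler]
  by (simp only: derivation_scale[OF derivation_euler] euler_lmon)
    (simp add: rf_const_mult rf_const_of_int mult_ac)

lemma \<Delta>_weighted: "\<Delta> b (weighted h) = weighted (\<lambda>u. h u * degree (L u) b)"
proof -
  have "\<Delta> b (weighted h) = (\<Sum>l\<in>{1..N}. \<Sum>u\<in>keys F. rf_const (L F u * of_int (h u * (\<beta> l b * L u l))) * lmon u)"
    unfolding \<Delta>_def euler_weighted unfolding weighted_def sum_distrib_left
    by (intro sum.cong HOL.refl) (simp add: rf_const_mult rf_const_of_int mult_ac)
  also have "\<dots> = (\<Sum>u\<in>keys F. \<Sum>l\<in>{1..N}. rf_const (L F u * of_int (h u * (\<beta> l b * L u l))) * lmon u)"
    by (rule sum.swap)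
  also have "\<dots> = weighted (\<lambda>u. h u * degree (L u) b)"
    by (simp add: weighted_def degree_def sum_distrib_left sum_distrib_right rf_const_sum)
  finally show ?thesis .
qed

lemma key_outside: "u \<in> keys F \<Longrightarrow> l \<notin> {1..N} \<Longrightarrow> L u l = 0"
proof -
  assume u: "u \<in> keys F" and l: "l \<notin> {1..N}"
  have "euler l f = 0"
    unfolding laurent derivation_sum[OF derivation_euler] using \<sigma>_equations(3) l by (intro sum.neutral) auto
  also have "0 = weighted (\<lambda>_. 0)" by (simp add: weighted_def rf_const_0)
  finally have "weighted (\<lambda>u. L u l) = weighted (\<lambda>_. 0)"
    unfolding f_weighted euler_weighted by simp
  then show ?thesis using u by (rule weighted_inject)
qed

text \<open>Only the sum of the \<sigma> is given as a Laurent polynomial, so degrees are read off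
  through projections: on \<open>f\<close> the \<open>\<Delta> b\<close> act as orthogonal
  projections with sum the identity. On each monomial their eigenvalues are orthogonal idempotents
  with sum 1.\<close>

lemma key_degree:
  assumes u: "u \<in> keys F"
  shows "\<exists>a\<in>{1..n}. \<forall>b\<in>{1..n}. degree (L u) b = \<alpha> a b"
proof -
  let ?d = "degree (L u)"
  have d1: "\<Delta> b f = weighted (\<lambda>u. degree (L u) b)" for b unfolding f_weighted \<Delta>_weighted by simp
  have idem: "?d b * ?d b' = (if b = b' then ?d b else 0)" if "b \<in> {1..n}" "b' \<in> {1..n}" for b b'
  proof -
    have "weighted (\<lambda>u. degree (L u) b * degree (L u) b') = \<Delta> b' (\<sigma> i b)"
      using \<Delta>_f[OF that(1)] unfolding d1 \<Delta>_weighted[symmetric] by simp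
    also have "\<dots> = (if b = b' then \<Delta> b f else 0)" using \<sigma>_equations(2) \<Delta>_f that by simp
    also have "\<dots> = weighted (\<lambda>u. if b = b' then degree (L u) b else 0)"
      unfolding d1 by (simp add: weighted_def rf_const_0)
    finally show ?thesis by (rule weighted_inject[OF _ u, THEN trans]) simp
  qed
  have "(\<Sum>b=1..n. \<Delta> b f) = (\<Sum>b=1..n. \<sigma> i b)" by (rule sum.cong) (simp_all only: \<Delta>_f)
  then have "f = (\<Sum>b=1..n. \<Delta> b f)" using laurent by (rule trans[symmetric, OF _ sym])
  also have "\<dots> = weighted (\<lambda>u. \<Sum>b=1..n. degree (L u) b)"
    unfolding d1 weighted_def
    by (subst sum.swap) (simp add: rf_const_sum sum_distrib_left sum_distrib_right)
  finally have "1 = (\<Sum>b=1..n. ?d b)" unfolding f_weighted by (rule weighted_inject[OF _ u])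
  then obtain a where a: "a \<in> {1..n}" "?d a \<noteq> 0" by (metis sum.neutral zero_neq_one)
  have "?d b = \<alpha> a b" if "b \<in> {1..n}" for b
    using idem[OF a(1) that] a(2) by (auto simp: \<alpha>_def split: if_splits)
  then show ?thesis using a(1) by blast
qed

lemma key_relation:
  assumes b: "b \<in> {1..n}"
  shows "(\<Sum>l\<in>{l\<in>{1..N}. \<iota> l = b}. of_int (L w l + 1) * L F (w - zt l)) = (if w = 0 then 1 else 0)"
proof -
  let ?P = "{l\<in>{1..N}. \<iota> l = b}"
  \<comment> \<open>A finite range for all exponents of \<open>\<Theta> b f\<close>, enlarged by 0
    for the right-hand side and by the exponent \<open>w\<close> whose coefficient is read
    off.\<close>
  let ?A = "insert w (insert 0 (\<Union>l\<in>?P. (\<lambda>u. u + zt l) ` keys F))"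
  let ?h = "\<lambda>w l. L F (w - zt l) * of_int (L (w - zt l) l)"
  have fin: "finite ?A" by simp
  have "1 = \<Theta> b f" using \<Theta>_f[OF b] by simp
  also have "\<dots> = (\<Sum>l\<in>?P. \<Sum>u\<in>keys F. rf_const (L F u * of_int (L u l)) * lmon (u + zt l))"
    unfolding \<Theta>_def f_weighted euler_weighted unfolding weighted_def sum_distrib_left
    by (intro sum.cong HOL.refl) (simp add: lmon_add mult_ac)
  also have "\<dots> = (\<Sum>l\<in>?P. \<Sum>v\<in>?A. rf_const (?h v l) * lmon v)"
  proof (rule sum.cong[OF HOL.refl])
    fix l assume l: "l \<in> ?P"
    have inj: "inj_on (\<lambda>u. u + zt l) (keys F)" by (rule inj_onI) simp
    have "(\<Sum>u\<in>keys F. rf_const (L F u * of_int (L u l)) * lmon (u + zt l)) =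
        (\<Sum>v\<in>(\<lambda>u. u + zt l) ` keys F. rf_const (?h v l) * lmon v)"
      unfolding sum.reindex[OF inj] by (simp add: comp_def)
    also have "\<dots> = (\<Sum>v\<in>?A. rf_const (?h v l) * lmon v)"
    proof (rule sum.mono_neutral_left[OF fin])
      show "(\<lambda>u. u + zt l) ` keys F \<subseteq> ?A" using l by blast
      show "\<forall>v\<in>?A - (\<lambda>u. u + zt l) ` keys F. rf_const (?h v l) * lmon v = 0"
      proof
        fix v assume v: "v \<in> ?A - (\<lambda>u. u + zt l) ` keys F"
        have "v - zt l \<notin> keys F"
        proof
          assume "v - zt l \<in> keys F"
          then have "v - zt l + zt l \<in> (\<lambda>u. u + zt l) ` keys F" by (rule imageI)
          then show False using v by simp
        qed
        then show "rf_const (?h v l) * lmon v = 0" by (simp add: in_keys_iff rf_const_0)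
      qed
    qed
    finally show "(\<Sum>u\<in>keys F. rf_const (L F u * of_int (L u l)) * lmon (u + zt l)) =
        (\<Sum>v\<in>?A. rf_const (?h v l) * lmon v)" .
  qed
  also have "\<dots> = (\<Sum>v\<in>?A. rf_const (\<Sum>l\<in>?P. ?h v l) * lmon v)"
    by (subst sum.swap) (simp add: rf_const_sum sum_distrib_right)
  finally have "(\<Sum>v\<in>?A. rf_const (\<Sum>l\<in>?P. ?h v l) * lmon v) = 1" by simp
  moreover have "(\<Sum>v\<in>?A. rf_const (if v = 0 then 1 else 0) * lmon v) = 1"
  proof -
    have "(\<Sum>v\<in>?A. rf_const (if v = 0 then 1 else 0) * lmon v) = (\<Sum>v\<in>?A. if v = 0 then 1 else 0)"
      by (rule sum.cong) (simp_all add: rf_const_0 rf_const_1)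
    also have "\<dots> = 1" using fin by (subst sum.delta) simp_all
    finally show ?thesis .
  qed
  ultimately have "(\<Sum>v\<in>?A. rf_const ((\<Sum>l\<in>?P. ?h v l) - (if v = 0 then 1 else 0)) * lmon v) = 0"
    by (simp only: rf_const_diff left_diff_distrib sum_subtractf) simp
  from lmon_independent[OF fin this, of w] have "(\<Sum>l\<in>?P. ?h w l) = (if w = 0 then 1 else 0)" by simp
  moreover have "?h w l = of_int (L w l + 1) * L F (w - zt l)" for l
    by (simp add: lookup_minus lookup_zt \<zeta>_def mult.commute)
  ultimately show ?thesis by simp
qed

text \<open>Functions of infinite support, where \<open>Abs_poly_mapping\<close> is unspecified, get
  the coefficient 0.\<close>

definition coef :: "(nat \<Rightarrow> int) \<Rightarrow> complex" where
  "coef u = (if finite {p. u p \<noteq> 0} then L F (Abs_poly_mapping u) else 0)"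

lemma coef_lookup [simp]: "coef (L u) = L F u"
  by (simp add: coef_def)

lemma coef_nonzero:
  assumes "coef u \<noteq> 0"
  obtains v where "v \<in> keys F" "u = L v"
proof -
  have "finite {p. u p \<noteq> 0}" "L F (Abs_poly_mapping u) \<noteq> 0"
    using assms by (auto simp: coef_def split: if_splits)
  then show ?thesis using that[of "Abs_poly_mapping u"] by (simp add: in_keys_iff)
qed

text \<open>On the exponents of \<open>F\<close> the choice is determined by
  \<open>key_degree\<close>; elsewhere it is arbitrary but still depends on the degree
  alone.\<close>

definition deg_letter :: "(nat \<Rightarrow> int) \<Rightarrow> nat" where
  "deg_letter u = (SOME a. a \<in> {1..n} \<and> (\<forall>b\<in>{1..n}. degree u b = \<alpha> a b))"

lemma deg_letter_eqI: "a \<in> {1..n} \<Longrightarrow> (\<And>b. b \<in> {1..n} \<Longrightarrow> degree u b = \<alpha> a b) \<Longrightarrow> deg_letter u = a"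
  unfolding deg_letter_def
proof (rule some_equality)
  fix a' assume a: "a \<in> {1..n}" "\<And>b. b \<in> {1..n} \<Longrightarrow> degree u b = \<alpha> a b"
    and a': "a' \<in> {1..n} \<and> (\<forall>b\<in>{1..n}. degree u b = \<alpha> a' b)"
  then have "\<alpha> a' a' = \<alpha> a a'" by metis
  then show "a' = a" by (simp add: \<alpha>_def split: if_splits)
qed blast

lemma degree_add: "degree (\<lambda>p. u p + v p) b = degree u b + degree v b"
  by (simp add: degree_def distrib_left sum.distrib)

lemma degree_uminus: "degree (\<lambda>p. - u p) b = - degree u b"
  by (simp add: degree_def sum_negf)

sublocale exponent_system N \<iota> c coef \<zeta> deg_letter
proof
  show "\<zeta> l p = (if p = l then - 1 else if l < p \<and> p \<le> N then - c (\<iota> p) (\<iota> l) else 0)" for l p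
    by (rule \<zeta>_def)
  show "c (\<iota> l) (\<iota> l) = 2" if "l \<in> {1..N}" for l using c_diag[OF \<iota>_range[OF that]] .
  show "c (\<iota> l) (\<iota> q) = c (\<iota> q) (\<iota> l) \<and> c (\<iota> l) (\<iota> q) \<in> {0, - 1}"
    if "l \<in> {1..N}" "q \<in> {1..N}" "\<iota> l \<noteq> \<iota> q" for l q
    using c_off[OF \<iota>_range[OF that(1)] \<iota>_range[OF that(2)] that(3)] .
  show out: "u l = 0" if "coef u \<noteq> 0" "l \<notin> {1..N}" for u l
    using coef_nonzero[OF that(1)] key_outside that(2) by metis
  show "finite {u. coef u \<noteq> 0}"
    by (rule finite_subset[of _ "L ` keys F"]) (auto elim: coef_nonzero)
  show bnd: "\<bar>u l\<bar> \<le> 1" if "coef u \<noteq> 0" for u l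
    using coef_nonzero[OF that] exponents out[OF that, of l] by (metis abs_zero zero_le_one)
  show "(\<Sum>l\<in>{l\<in>{1..N}. \<iota> l = b}. of_int (w l + 1) * coef (\<lambda>p. w p - \<zeta> l p)) = 0"
    if "b \<in> \<iota> ` {1..N}" "w \<noteq> (\<lambda>_. 0)" for b w
  proof (cases "finite {p. w p \<noteq> 0}")
    case True
    then obtain v where v: "w = L v" by (metis lookup_Abs_poly_mapping)
    have "(\<lambda>p. w p - \<zeta> l p) = L (v - zt l)" for l by (simp add: v lookup_minus lookup_zt fun_eq_iff)
    moreover have "v \<noteq> 0" using that(2) v by auto
    ultimately show ?thesis using key_relation[of b v] that(1) \<iota>_range v by auto
  next
    case False
    \<comment> \<open>\<open>\<zeta> l\<close> has finite support, so its difference from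
      \<open>w\<close> is no exponent.\<close>
    have "coef (\<lambda>p. w p - \<zeta> l p) = 0" for l
    proof (rule ccontr)
      assume "coef (\<lambda>p. w p - \<zeta> l p) \<noteq> 0"
      then obtain v where v: "(\<lambda>p. w p - \<zeta> l p) = L v" using coef_nonzero by metis
      have "w p = L (v + zt l) p" for p using fun_cong[OF v, of p] by (simp add: lookup_add lookup_zt)
      then have "w = L (v + zt l)" by blast
      then show False using False by simp
    qed
    then show ?thesis by simp
  qed
  show "\<exists>l. u l = 1" if u: "coef u \<noteq> 0" for u
  proof (rule ccontr)
    assume no: "\<not> ?thesis"
    have "u l \<le> 0" for l using bnd[OF u, of l] no by (metis abs_le_D1 int_one_le_iff_zero_less order_antisym not_le)
    obtain v where v: "v \<in> keys F" "u = L v" using coef_nonzero[OF u] .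
    obtain a where a: "a \<in> {1..n}" "\<And>b. b \<in> {1..n} \<Longrightarrow> degree (L v) b = \<alpha> a b" using key_degree[OF v(1)] by blast
    \<comment> \<open>The attached roots are nonnegative, whereas the degree of \<open>u\<close> has
      coefficient 1 at \<open>a\<close>.\<close>
    have "degree u a \<le> 0" unfolding degree_def
      using \<beta>_nonneg \<open>\<And>l. u l \<le> 0\<close> by (intro sum_nonpos mult_nonneg_nonpos) auto
    then show False using a(2)[OF a(1)] v(2) by (simp add: \<alpha>_def)
  qed
  show "deg_letter (\<lambda>p. u p + \<zeta> l p - \<zeta> l' p) = deg_letter u"
    if "l \<in> {1..N}" "l' \<in> {1..N}" "\<iota> l = \<iota> l'" for l l' u
  proof -
    have "degree (\<lambda>p. u p + \<zeta> l p - \<zeta> l' p) b = degree u b" for b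
      using degree_add[of "\<lambda>p. u p + \<zeta> l p" "\<lambda>p. - \<zeta> l' p"] degree_add[of u "\<zeta> l"]
      by (simp add: degree_uminus degree_\<zeta>[OF that(1)] degree_\<zeta>[OF that(2)] that(3))
    then show ?thesis by (simp add: deg_letter_def)
  qed
  show "deg_letter (\<lambda>p. - \<zeta> l p) = \<iota> l" if "l \<in> {1..N}" for l
    using \<iota>_range[OF that] by (rule deg_letter_eqI) (simp add: degree_uminus degree_\<zeta>[OF that])
qed

lemma not_redundant: "\<not> redundant N F"
proof
  assume "redundant N F"
  then obtain u0 a where u0: "u0 \<in> keys F" and a: "\<And>u. u \<in> keys F - {u0} \<Longrightarrow> 0 \<le> a u"
    and lin: "\<And>t. lin_form N u0 t = (\<Sum>u\<in>keys F - {u0}. a u * lin_form N u t)"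
    unfolding redundant_def by blast
  let ?A = "keys F - {u0}"
  have coord: "real_of_int (L u0 l) = (\<Sum>u\<in>?A. a u * of_int (L u l))" for l
  proof (cases "l \<in> {1..N}")
    case True
    have "lin_form N u (\<lambda>k. if k = l then 1 else 0) = of_int (L u l)" for u
    proof -
      have "lin_form N u (\<lambda>k. if k = l then 1 else 0) = (\<Sum>k=1..N. if k = l then of_int (L u l) else 0)"
        unfolding lin_form_def by (intro sum.cong) auto
      then show ?thesis using True by simp
    qed
    then show ?thesis using lin[of "\<lambda>k. if k = l then 1 else 0"] by simp
  next
    case False
    then show ?thesis using key_outside u0 by simp
  qed
  have deg: "real_of_int (degree (L u0) b) = (\<Sum>u\<in>?A. a u * of_int (degree (L u) b))" for b
  proof -
    have "real_of_int (degree (L u0) b) = (\<Sum>l\<in>{1..N}. \<Sum>u\<in>?A. of_int (\<beta> l b) * (a u * of_int (L u l)))"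
      by (simp add: degree_def coord sum_distrib_left)
    also have "\<dots> = (\<Sum>u\<in>?A. \<Sum>l\<in>{1..N}. of_int (\<beta> l b) * (a u * of_int (L u l)))" by (rule sum.swap)
    also have "\<dots> = (\<Sum>u\<in>?A. a u * of_int (degree (L u) b))"
      by (simp add: degree_def sum_distrib_left mult_ac)
    finally show ?thesis .
  qed
  have letter: "deg_letter (L u) \<in> {1..n} \<and> (\<forall>b\<in>{1..n}. degree (L u) b = \<alpha> (deg_letter (L u)) b)"
    if "u \<in> keys F" for u
    using key_degree[OF that] deg_letter_eqI by metis
  let ?a0 = "deg_letter (L u0)"
  \<comment> \<open>At any other simple root the coefficient of \<open>u0\<close> is 0 and a sum of
    nonnegative terms, so every exponent with nonzero weight has the degree of
    \<open>u0\<close>.\<close>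
  have same: "deg_letter (L u) = ?a0" if u: "u \<in> ?A" "a u \<noteq> 0" for u
  proof (rule ccontr)
    let ?b = "deg_letter (L u)"
    assume ne: "?b \<noteq> ?a0"
    have b: "?b \<in> {1..n}" using letter u by blast
    have "degree (L u0) ?b = 0" using letter[OF u0] b ne by (auto simp: \<alpha>_def)
    then have "(\<Sum>u\<in>?A. a u * of_int (degree (L u) ?b)) = 0" using deg[of ?b] by simp
    moreover have "0 \<le> a v * of_int (degree (L v) ?b)" if "v \<in> ?A" for v
      using a[OF that] letter[of v] b that by (auto simp: \<alpha>_def)
    ultimately have "a u * of_int (degree (L u) ?b) = 0"
      using u(1) by (subst (asm) sum_nonneg_eq_0_iff) auto
    then show False using u letter[of u] by (auto simp: \<alpha>_def)
  qed
  \<comment> \<open>Comparing the coefficient at this common degree shows that the combination is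
    convex.\<close>
  have total: "(\<Sum>u\<in>?A. a u) = 1"
  proof -
    have "(\<Sum>u\<in>?A. a u) = (\<Sum>u\<in>?A. a u * of_int (degree (L u) ?a0))"
    proof (rule sum.cong[OF HOL.refl])
      fix u assume u: "u \<in> ?A"
      show "a u = a u * of_int (degree (L u) ?a0)"
      proof (cases "a u = 0")
        case False
        then show ?thesis using same[OF u False] letter[of u] u by (auto simp: \<alpha>_def)
      qed simp
    qed
    also have "\<dots> = of_int (degree (L u0) ?a0)" using deg by simp
    also have "\<dots> = 1" using letter[OF u0] by (simp add: \<alpha>_def)
    finally show ?thesis .
  qed
  then obtain u1 where u1: "u1 \<in> ?A" "a u1 \<noteq> 0" by (metis sum.neutral zero_neq_one)
  then have "L u1 \<noteq> L u0" by (metis DiffE insertI1 poly_mapping.lookup_inject)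
  then have ex: "\<exists>p. \<exists>u\<in>?A. a u \<noteq> 0 \<and> L u p \<noteq> L u0 p" using u1 by (auto simp: fun_eq_iff)
  \<comment> \<open>The first position where an exponent with nonzero weight differs from
    \<open>u0\<close>. The weighted mean of the differences there is 0, so both signs occur.\<close>
  define k where "k = (LEAST p. \<exists>u\<in>?A. a u \<noteq> 0 \<and> L u p \<noteq> L u0 p)"
  obtain v where v: "v \<in> ?A" "a v \<noteq> 0" "L v k \<noteq> L u0 k"
    using LeastI_ex[OF ex] unfolding k_def by blast
  have prefix: "L u p = L u0 p" if "u \<in> ?A" "a u \<noteq> 0" "p < k" for u p
    using not_less_Least[of p "\<lambda>p. \<exists>u\<in>?A. a u \<noteq> 0 \<and> L u p \<noteq> L u0 p"] that unfolding k_def by blast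
  have zero: "(\<Sum>u\<in>?A. a u * of_int (L u k - L u0 k)) = 0"
    using total coord[of k] by (simp add: right_diff_distrib sum_subtractf flip: sum_distrib_right)
  have pos: "\<exists>u\<in>?A. a u \<noteq> 0 \<and> L u0 k < L u k"
  proof (rule ccontr)
    assume "\<not> ?thesis"
    then have "a u * of_int (L u k - L u0 k) \<le> 0" if "u \<in> ?A" for u
      using a[OF that] that by (cases "a u = 0") (auto simp: mult_le_0_iff not_less)
    then have "a v * of_int (L v k - L u0 k) = 0"
      using zero v(1) sum_nonneg_eq_0_iff[of ?A "\<lambda>u. - (a u * of_int (L u k - L u0 k))"]
      by (simp add: sum_negf)
    then show False using v by simp
  qed
  have neg: "\<exists>u\<in>?A. a u \<noteq> 0 \<and> L u k < L u0 k"
  proof (rule ccontr)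
    assume "\<not> ?thesis"
    then have "0 \<le> a u * of_int (L u k - L u0 k)" if "u \<in> ?A" for u
      using a[OF that] that by (cases "a u = 0") auto
    then have "a v * of_int (L v k - L u0 k) = 0"
      using zero v(1) by (subst (asm) sum_nonneg_eq_0_iff) auto
    then show False using v by simp
  qed
  obtain u where u: "u \<in> ?A" "a u \<noteq> 0" "L u0 k < L u k" using pos by blast
  obtain u' where u': "u' \<in> ?A" "a u' \<noteq> 0" "L u' k < L u0 k" using neg by blast
  have C: "coef (L u) \<noteq> 0" "coef (L u') \<noteq> 0" using u(1) u'(1) by (auto simp: in_keys_iff)
  \<comment> \<open>\<open>L u0 k\<close> lies strictly between these two integers, which the bound
    confines to -1, 0, 1.\<close>
  have "L u k = 1" "L u' k = - 1"
    using bounds[OF C(1), of k] bounds[OF C(2), of k] u(3) u'(3) by linarith+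
  then show False
    using no_opposite[OF C, of k] same u u' prefix by metis
qed

end

theorem theorem1:
  fixes scale :: "complex \<Rightarrow> 'g::ab_group_add \<Rightarrow> 'g"
    and bracket :: "'g \<Rightarrow> 'g \<Rightarrow> 'g"
    and n :: nat
    and c :: "nat \<Rightarrow> nat \<Rightarrow> int"
    and w0 :: "(nat \<Rightarrow> int) \<Rightarrow> (nat \<Rightarrow> int)"
    and \<sigma> :: "nat list \<Rightarrow> nat \<Rightarrow> ratfun"
    and i :: "nat list"
    and F :: laurent
  assumes "complex_lie_algebra scale bracket"
    and "complex_lie_algebra.simple scale bracket"
    and "complex_lie_algebra.is_cartan_matrix scale bracket n c"
    and "simply_laced n c"
    and "longest_element n c w0"
    and "i \<in> reduced_words n c w0"
    and "varsigma_family n c w0 \<sigma>"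
    and "laurent_to_rf F = (\<Sum>a=1..n. \<sigma> i a)"
    and "\<forall>u\<in>Poly_Mapping.keys F. \<forall>k\<in>{1..length i}. \<bar>Poly_Mapping.lookup u k\<bar> \<le> 1"
  shows "\<not> redundant (length i) F"
proof -
  interpret complex_lie_algebra scale bracket by fact
  \<comment> \<open>A simple root takes the value 2 on its coroot.\<close>
  have diag: "c j j = 2" if j: "j \<in> {1..n}" for j
  proof -
    obtain H \<alpha> h where "coroot H (\<alpha> j) (h j)" "of_int (c j j) = \<alpha> j (h j)"
      using assms(3) j unfolding is_cartan_matrix_def by blast
    then have "complex_of_int (c j j) = 2" by (simp add: coroot_def)
    then show ?thesis using of_int_eq_iff[of "c j j" 2, where ?'a = complex] by simp
  qed
  interpret longest_word n c w0 \<sigma> i F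
    by unfold_locales (use diag assms in \<open>auto simp: simply_laced_def\<close>)
  show ?thesis by (rule not_redundant)
qed

end
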